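(* (In $\mathsf{ZF}$.) Let $V$ be a $\mathbb{Q}$-vector space that has a basis. Then $V\not\to(3)^{\operatorname{FS}}_{\omega}$. That is, there exists a colouring $c:V\to\omega$ such that there are no three distinct vectors $u,v,w\in V$ for which $\operatorname{FS}(\{u,v,w\})$ is $c$-monochromatic.
   Context: The base theory is $\mathsf{ZF}$ (no form of the Axiom of Choice is assumed). The basis of $V$ is a Hamel basis over $\mathbb{Q}$, not assumed well-orderable. For $X\subseteq V$, $\operatorname{FS}(X)=\{\sum_{a\in F}a : F\subseteq X \text{ finite and nonempty}\}$. A set is $c$-monochromatic if $c$ is constant on it. *)

theory Defs
  imports "HOL-Algebra.Module"
begin

text \<open>
  HOL itself contains a choice operator, so a theorem of ZF without choice is stated here as
  a theorem about every model of first-order ZF. By the completeness theorem of first-order logic,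
  a set-theoretic sentence holds in all these models iff it is provable in ZF. A model is an
  arbitrary binary relation \<open>E\<close> on a HOL type, with \<open>E x y\<close> read as ``\<open>x\<close> is a member of \<open>y\<close>''.
  It need be neither well-founded nor \<open>\<omega>\<close>-standard.
\<close>

subsection \<open>First-order ZF\<close>

datatype fm = Mem nat nat | Eq nat nat | Neg fm | Conj fm fm | All nat fm

fun sat :: "('m \<Rightarrow> 'm \<Rightarrow> bool) \<Rightarrow> (nat \<Rightarrow> 'm) \<Rightarrow> fm \<Rightarrow> bool" where
  "sat E s (Mem i j) \<longleftrightarrow> E (s i) (s j)"
| "sat E s (Eq i j) \<longleftrightarrow> s i = s j"
| "sat E s (Neg p) \<longleftrightarrow> \<not> sat E s p"
| "sat E s (Conj p q) \<longleftrightarrow> sat E s p \<and> sat E s q"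
| "sat E s (All i p) \<longleftrightarrow> (\<forall>x. sat E (s(i := x)) p)"

definition empty_set :: "('m \<Rightarrow> 'm \<Rightarrow> bool) \<Rightarrow> 'm" where
  "empty_set E = (THE z. \<forall>x. \<not> E x z)"

definition succ_set :: "('m \<Rightarrow> 'm \<Rightarrow> bool) \<Rightarrow> 'm \<Rightarrow> 'm" where
  "succ_set E n = (THE m. \<forall>x. E x m \<longleftrightarrow> E x n \<or> x = n)"

definition is_inductive :: "('m \<Rightarrow> 'm \<Rightarrow> bool) \<Rightarrow> 'm \<Rightarrow> bool" where
  "is_inductive E a \<longleftrightarrow>
     (\<exists>z. (\<forall>x. \<not> E x z) \<and> E z a) \<and>
     (\<forall>n. E n a \<longrightarrow> (\<exists>m. (\<forall>x. E x m \<longleftrightarrow> E x n \<or> x = n) \<and> E m a))"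

text \<open>
  In the two schemas the formula \<open>\<phi>\<close> ranges over the deeply embedded formulas only: with
  arbitrary HOL predicates in their place, choice in HOL would force the axiom of choice on
  the model. The valuation \<open>s\<close> supplies the parameters of \<open>\<phi>\<close>.
\<close>

locale ZF_model =
  fixes E :: "'m \<Rightarrow> 'm \<Rightarrow> bool"
  assumes extensionality: "(\<forall>x. E x a \<longleftrightarrow> E x b) \<Longrightarrow> a = b"
    and foundation: "\<exists>x. E x a \<Longrightarrow> \<exists>x. E x a \<and> \<not> (\<exists>y. E y x \<and> E y a)"
    and pairing: "\<exists>c. \<forall>x. E x c \<longleftrightarrow> x = a \<or> x = b"
    and union: "\<exists>c. \<forall>x. E x c \<longleftrightarrow> (\<exists>y. E y a \<and> E x y)"
    and power_set: "\<exists>c. \<forall>x. E x c \<longleftrightarrow> (\<forall>y. E y x \<longrightarrow> E y a)"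
    and infinity: "\<exists>a. is_inductive E a"
    and separation: "\<exists>c. \<forall>x. E x c \<longleftrightarrow> E x a \<and> sat E (s(0 := x)) \<phi>"
    and replacement: "(\<And>x. E x a \<Longrightarrow> \<exists>!y. sat E (s(0 := x, 1 := y)) \<phi>) \<Longrightarrow>
      \<exists>c. \<forall>y. E y c \<longleftrightarrow> (\<exists>x. E x a \<and> sat E (s(0 := x, 1 := y)) \<phi>)"

subsection \<open>Sets and functions of a model\<close>

text \<open>
  A set of the model is identified with the HOL set of its members. A HOL set of points of the
  model is internal if it arises in this way, and a function is internal if its graph, formed
  with Kuratowski pairs of the model, is.
\<close>

definition upair :: "('m \<Rightarrow> 'm \<Rightarrow> bool) \<Rightarrow> 'm \<Rightarrow> 'm \<Rightarrow> 'm" where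
  "upair E x y = (THE p. \<forall>z. E z p \<longleftrightarrow> z = x \<or> z = y)"

definition opair :: "('m \<Rightarrow> 'm \<Rightarrow> bool) \<Rightarrow> 'm \<Rightarrow> 'm \<Rightarrow> 'm" where
  "opair E x y = upair E (upair E x x) (upair E x y)"

definition internal_set :: "('m \<Rightarrow> 'm \<Rightarrow> bool) \<Rightarrow> 'm set \<Rightarrow> bool" where
  "internal_set E X \<longleftrightarrow> (\<exists>a. X = {x. E x a})"

definition internal_fun ::
  "('m \<Rightarrow> 'm \<Rightarrow> bool) \<Rightarrow> 'm set \<Rightarrow> 'm set \<Rightarrow> ('m \<Rightarrow> 'm) \<Rightarrow> bool" where
  "internal_fun E A B f \<longleftrightarrow> (\<forall>x\<in>A. f x \<in> B) \<and> internal_set E {opair E x (f x) | x. x \<in> A}"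

definition internal_fun2 ::
  "('m \<Rightarrow> 'm \<Rightarrow> bool) \<Rightarrow> 'm set \<Rightarrow> 'm set \<Rightarrow> 'm set \<Rightarrow> ('m \<Rightarrow> 'm \<Rightarrow> 'm) \<Rightarrow> bool" where
  "internal_fun2 E A B C f \<longleftrightarrow> (\<forall>x\<in>A. \<forall>y\<in>B. f x y \<in> C) \<and>
     internal_set E {opair E (opair E x y) (f x y) | x y. x \<in> A \<and> y \<in> B}"

text \<open>The \<open>\<omega>\<close> of the model, which may contain nonstandard numbers:\<close>

definition omega :: "('m \<Rightarrow> 'm \<Rightarrow> bool) \<Rightarrow> 'm set" where
  "omega E = {n. \<forall>a. is_inductive E a \<longrightarrow> E n a}"

subsection \<open>Vector spaces over the rationals of a model\<close>

text \<open>
  The field \<open>\<rat>\<close> is determined up to unique isomorphism as the field of characteristic \<open>0\<close> all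
  of whose elements are quotients \<open>(a - b) / d\<close> with \<open>a\<close>, \<open>b\<close>, \<open>d\<close> natural numbers. Here \<open>j\<close> is
  the canonical map \<open>n \<mapsto> n \<cdot> 1\<close> from \<open>\<omega>\<close>, and its injectivity says that the characteristic
  is \<open>0\<close>.
\<close>

definition rational_field :: "('m \<Rightarrow> 'm \<Rightarrow> bool) \<Rightarrow> 'm ring \<Rightarrow> bool" where
  "rational_field E Q \<longleftrightarrow>
     field Q \<and>
     internal_set E (carrier Q) \<and>
     internal_fun2 E (carrier Q) (carrier Q) (carrier Q) (add Q) \<and>
     internal_fun2 E (carrier Q) (carrier Q) (carrier Q) (mult Q) \<and>
     (\<exists>j. internal_fun E (omega E) (carrier Q) j \<and>
        inj_on j (omega E) \<and>
        j (empty_set E) = \<zero>\<^bsub>Q\<^esub> \<and>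
        (\<forall>n\<in>omega E. j (succ_set E n) = j n \<oplus>\<^bsub>Q\<^esub> \<one>\<^bsub>Q\<^esub>) \<and>
        (\<forall>q\<in>carrier Q. \<exists>a\<in>omega E. \<exists>b\<in>omega E. \<exists>d\<in>omega E.
           j d \<noteq> \<zero>\<^bsub>Q\<^esub> \<and> q = (j a \<ominus>\<^bsub>Q\<^esub> j b) \<otimes>\<^bsub>Q\<^esub> inv\<^bsub>Q\<^esub> (j d)))"

text \<open>
  The record type of modules extends that of rings. The multiplication and unit of the record
  \<open>V\<close> are not part of the module structure and remain unconstrained.
\<close>

definition vector_space_in ::
  "('m \<Rightarrow> 'm \<Rightarrow> bool) \<Rightarrow> 'm ring \<Rightarrow> ('m, 'm) module \<Rightarrow> bool" where
  "vector_space_in E K V \<longleftrightarrow>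
     module K V \<and>
     internal_set E (carrier V) \<and>
     internal_fun2 E (carrier V) (carrier V) (carrier V) (add V) \<and>
     internal_fun2 E (carrier K) (carrier V) (carrier V) (smult V)"

text \<open>
  The linear span in the sense of the model, as the least subspace containing \<open>X\<close>. Only internal
  subspaces may be considered: the finite linear combinations of the model are allowed to have
  nonstandard length.
\<close>

definition span_in ::
  "('m \<Rightarrow> 'm \<Rightarrow> bool) \<Rightarrow> 'm ring \<Rightarrow> ('m, 'm) module \<Rightarrow> 'm set \<Rightarrow> 'm set" where
  "span_in E K V X =
     \<Inter> {W. internal_set E W \<and> submodule W K V \<and> X \<subseteq> W}"

definition hamel_basis ::
  "('m \<Rightarrow> 'm \<Rightarrow> bool) \<Rightarrow> 'm ring \<Rightarrow> ('m, 'm) module \<Rightarrow> 'm set \<Rightarrow> bool" where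
  "hamel_basis E K V B \<longleftrightarrow>
     internal_set E B \<and> B \<subseteq> carrier V \<and>
     (\<forall>b\<in>B. b \<notin> span_in E K V (B - {b})) \<and>
     span_in E K V B = carrier V"

text \<open>
  Finiteness here is that of HOL. For sets \<open>X\<close> with three elements, to which this is
  applied, it agrees with finiteness in the model.
\<close>

definition FS :: "('m, 'm) module \<Rightarrow> 'm set \<Rightarrow> 'm set" where
  "FS V X = {finsum V (\<lambda>a. a) F | F. F \<subseteq> X \<and> finite F \<and> F \<noteq> {}}"

definition monochromatic :: "('m \<Rightarrow> 'm) \<Rightarrow> 'm set \<Rightarrow> bool" where
  "monochromatic c X \<longleftrightarrow> (\<forall>x\<in>X. \<forall>y\<in>X. c x = c y)"

end

theory Submission
  imports Defs
begin

text \<open>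
  Colour a vector by the sum \<open>N(v)\<close> of the squares of its coordinates with respect to the basis. This
  takes values in \<open>\<rat>\<close>, which is countable, and no ordering of the basis is involved, so no choice
  is used. The map \<open>N\<close> is a quadratic form, whence
  \<open>N(u + v + w) + N(u) + N(v) + N(w) = N(u + v) + N(u + w) + N(v + w)\<close>.
  If \<open>N\<close> takes a single value \<open>s\<close> on \<open>FS({u, v, w})\<close>, this says \<open>4s = 3s\<close>, so \<open>s = 0\<close>. A sum of squares of
  rationals vanishes only if every summand does, so \<open>u = v = w = 0\<close>, and the three vectors are not
  distinct (lemmas \<open>norm2_quadratic\<close>, \<open>norm2_definite\<close>, \<open>norm2_not_constant_on_FS\<close>).

  The work lies in showing that the colouring is a set of the model, whose natural numbers may be
  nonstandard, so that sums of internally finite length are not finite sums of HOL. Three devices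
  keep this manageable.

  \<^item> A predicate on valuations is \<open>definable\<close> if it is given by a formula with parameters. The
    introduction rules \<open>definable_intros\<close> follow the shape of a term and hand separation to
    HOL expressions directly.

  \<^item> Finite sums are avoided. Every internal set that contains \<open>0\<close> and is closed under the maps
    \<open>v \<mapsto> v + q b\<close>, with \<open>b\<close> in the basis, is the whole space (\<open>vector_induct\<close>). The graph of \<open>N\<close> is
    the least relation that contains \<open>(0, 0)\<close> and passes from \<open>(v, r)\<close> to \<open>(v + q b, r + q\<^sup>2)\<close> whenever \<open>v\<close>
    lies in the span of the basis without \<open>b\<close>. It is single-valued because the coordinate
    at any basis vector can be deleted again, together with its square (\<open>square_sum_remove\<close>).

  \<^item> The natural numbers are handled inside the field of rationals, where addition and
    multiplication are already at hand. There \<open>(a + d)\<^sup>2 + a\<close> codes the pair \<open>(a, d)\<close>, and the least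
    code of a fraction representing \<open>N(v)\<close>, pulled back to \<open>\<omega>\<close>, is the colour.
\<close>

section \<open>Definable predicates\<close>

fun rename :: "(nat \<Rightarrow> nat) \<Rightarrow> fm \<Rightarrow> fm" where
  "rename f (Mem i j) = Mem (f i) (f j)"
| "rename f (Eq i j) = Eq (f i) (f j)"
| "rename f (Neg p) = Neg (rename f p)"
| "rename f (Conj p q) = Conj (rename f p) (rename f q)"
| "rename f (All i p) = All (f i) (rename f p)"

text \<open>
  Injectivity on all variables, free or bound, keeps the renaming from capturing any.
\<close>

lemma sat_rename: "inj f \<Longrightarrow> sat E s (rename f p) \<longleftrightarrow> sat E (s \<circ> f) p"
proof (induction p arbitrary: s)
  case (All i p)
  have "s(f i := x) \<circ> f = (s \<circ> f)(i := x)" for x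
    using All.prems by (auto simp: fun_eq_iff inj_eq)
  then show ?case by (simp only: rename.simps sat.simps All.IH[OF All.prems])
qed auto

text \<open>
  Formulas have one kind of variable. The even ones carry the arguments of a predicate and the odd ones
  its parameters, which leaves room for infinitely many of both.
\<close>

definition mix :: "(nat \<Rightarrow> 'm) \<Rightarrow> (nat \<Rightarrow> 'm) \<Rightarrow> nat \<Rightarrow> 'm" where
  "mix s p i = (if even i then s (i div 2) else p (i div 2))"

lemma mix_even [simp]: "mix s p (2 * i) = s i" and mix_odd [simp]: "mix s p (Suc (2 * i)) = p i"
  by (simp_all add: mix_def)

context ZF_model
begin

text \<open>
  The quantification over the reindexing \<open>\<tau>\<close> of the arguments, which need not be injective, makes closure under
  substitution of variables immediate. With a fixed formula it would require a renaming of
  bound variables.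
\<close>

definition definable :: "((nat \<Rightarrow> 'm) \<Rightarrow> bool) \<Rightarrow> bool" where
  "definable P \<longleftrightarrow> (\<forall>\<tau>. \<exists>\<phi> p. \<forall>s. P (s \<circ> \<tau>) \<longleftrightarrow> sat E (mix s p) \<phi>)"

text \<open>
  Arguments are de Bruijn indices: the value is argument \<open>0\<close>, and the arguments of \<open>f\<close> move up by one.
\<close>

definition definable_fun :: "((nat \<Rightarrow> 'm) \<Rightarrow> 'm) \<Rightarrow> bool" where
  "definable_fun f \<longleftrightarrow> definable (\<lambda>s. s 0 = f (\<lambda>i. s (Suc i)))"

lemma definable_reindex:
  assumes "definable P" shows "definable (\<lambda>s. P (\<lambda>i. s (\<tau> i)))"
  unfolding definable_def
proof
  fix \<sigma>
  show "\<exists>\<phi> p. \<forall>s. P (\<lambda>i. (s \<circ> \<sigma>) (\<tau> i)) \<longleftrightarrow> sat E (mix s p) \<phi>"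
    using assms[unfolded definable_def, rule_format, of "\<sigma> \<circ> \<tau>"] by (simp add: comp_def)
qed

lemma definable_mem_var: "definable (\<lambda>s. E (s i) (s j))"
  unfolding definable_def
proof
  fix \<tau> show "\<exists>\<phi> p. \<forall>s. E ((s \<circ> \<tau>) i) ((s \<circ> \<tau>) j) \<longleftrightarrow> sat E (mix s p) \<phi>"
    by (rule exI[of _ "Mem (2 * \<tau> i) (2 * \<tau> j)"]) (simp add: mix_def)
qed

lemma definable_eq_var: "definable (\<lambda>s. s i = s j)"
  unfolding definable_def
proof
  fix \<tau> show "\<exists>\<phi> p. \<forall>s. (s \<circ> \<tau>) i = (s \<circ> \<tau>) j \<longleftrightarrow> sat E (mix s p) \<phi>"
    by (rule exI[of _ "Eq (2 * \<tau> i) (2 * \<tau> j)"]) (simp add: mix_def)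
qed

lemma definable_eq_const: "definable (\<lambda>s. s i = c)"
  unfolding definable_def
proof
  fix \<tau> show "\<exists>\<phi> p. \<forall>s. (s \<circ> \<tau>) i = c \<longleftrightarrow> sat E (mix s p) \<phi>"
    by (rule exI[of _ "Eq (2 * \<tau> i) 1"], rule exI[of _ "\<lambda>_. c"]) (simp add: mix_def)
qed

named_theorems definable_intros

lemma definable_not [definable_intros]:
  assumes "definable P" shows "definable (\<lambda>s. \<not> P s)"
  unfolding definable_def
proof
  fix \<tau>
  obtain \<phi> p where "\<forall>s. P (s \<circ> \<tau>) \<longleftrightarrow> sat E (mix s p) \<phi>"
    using assms unfolding definable_def by blast
  then show "\<exists>\<phi> p. \<forall>s. (\<not> P (s \<circ> \<tau>)) \<longleftrightarrow> sat E (mix s p) \<phi>"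
    by (intro exI[of _ "Neg \<phi>"] exI[of _ p]) simp
qed

lemma definable_conj [definable_intros]:
  assumes "definable P" "definable P'" shows "definable (\<lambda>s. P s \<and> P' s)"
  unfolding definable_def
proof
  fix \<tau>
  obtain \<phi> p where \<phi>: "\<And>s. P (s \<circ> \<tau>) \<longleftrightarrow> sat E (mix s p) \<phi>"
    using assms(1) unfolding definable_def by blast
  obtain \<psi> q where \<psi>: "\<And>s. P' (s \<circ> \<tau>) \<longleftrightarrow> sat E (mix s q) \<psi>"
    using assms(2) unfolding definable_def by blast
  \<comment> \<open>The parameters of the two formulas are interleaved: \<open>p i\<close> becomes parameter \<open>2 i\<close> and \<open>q i\<close> parameter \<open>2 i + 1\<close>.\<close>
  define f g :: "nat \<Rightarrow> nat" where "f = (\<lambda>i. if even i then i else 2 * i - 1)"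
    and "g = (\<lambda>i. if even i then i else 2 * i + 1)"
  have inj_f: "inj f" by (rule injI) (auto simp: f_def split: if_splits; presburger)
  have inj_g: "inj g" by (rule injI) (auto simp: g_def split: if_splits; presburger)
  have f: "f (2 * k) = 2 * k" "f (Suc (2 * k)) = Suc (2 * (2 * k))"
    and g: "g (2 * k) = 2 * k" "g (Suc (2 * k)) = Suc (2 * Suc (2 * k))" for k
    by (simp_all add: f_def g_def)
  have "mix s (mix p q) (f i) = mix s p i \<and> mix s (mix p q) (g i) = mix s q i" for s i
  proof -
    consider k where "i = 2 * k" | k where "i = Suc (2 * k)" by (metis evenE oddE Suc_eq_plus1)
    then show ?thesis by cases (simp_all only: f g mix_even mix_odd)
  qed
  then have "mix s (mix p q) \<circ> f = mix s p" "mix s (mix p q) \<circ> g = mix s q" for s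
    by (simp_all add: fun_eq_iff)
  then have "(P (s \<circ> \<tau>) \<and> P' (s \<circ> \<tau>)) \<longleftrightarrow> sat E (mix s (mix p q)) (Conj (rename f \<phi>) (rename g \<psi>))" for s
    by (simp add: \<phi> \<psi> sat_rename inj_f inj_g)
  then show "\<exists>\<phi> p. \<forall>s. (P (s \<circ> \<tau>) \<and> P' (s \<circ> \<tau>)) \<longleftrightarrow> sat E (mix s p) \<phi>" by blast
qed

text \<open>
  The premise is stated with \<open>P\<close> applied to the shifted valuation so that, after unification with
  a concrete quantified formula, its body appears with de Bruijn indices.
\<close>

lemma definable_all [definable_intros]:
  assumes "definable (\<lambda>s. P (\<lambda>i. s (Suc i)) (s 0))" shows "definable (\<lambda>s. \<forall>x. P s x)"
  unfolding definable_def
proof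
  fix \<tau> :: "nat \<Rightarrow> nat"
  define \<tau>' where "\<tau>' = case_nat 0 (\<lambda>i. Suc (\<tau> i))"
  obtain \<phi> p where "\<forall>s. P (\<lambda>i. (s \<circ> \<tau>') (Suc i)) ((s \<circ> \<tau>') 0) \<longleftrightarrow> sat E (mix s p) \<phi>"
    using assms unfolding definable_def by blast
  from spec[OF this, of "case_nat x s" for x s]
  have \<phi>: "P (s \<circ> \<tau>) x \<longleftrightarrow> sat E (mix (case_nat x s) p) \<phi>" for s x
    by (simp add: \<tau>'_def comp_def)
  \<comment> \<open>Variable \<open>1\<close>, the first parameter, is freed for the bound variable; arguments move down and parameters up.\<close>
  define f :: "nat \<Rightarrow> nat" where "f = (\<lambda>i. if i = 0 then 1 else if even i then i - 2 else i + 2)"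
  have inj: "inj f" by (rule injI) (auto simp: f_def split: if_splits; presburger)
  define p' where "p' = case_nat undefined p"
  have *: "((mix s p')(1 := x)) \<circ> f = mix (case_nat x s) p" for s x
  proof
    fix i
    consider "i = 0" | k where "i = 2 * Suc k" | k where "i = Suc (2 * k)"
      by (metis evenE oddE Suc_eq_plus1 mult_0_right not0_implies_Suc)
    then show "(((mix s p')(1 := x)) \<circ> f) i = mix (case_nat x s) p i"
    proof cases
      case (2 k) then have "f i = 2 * k" by (simp add: f_def)
      with 2 show ?thesis by (simp only: comp_apply mix_even fun_upd_apply nat.case) presburger
    next
      case (3 k) then have "f i = Suc (2 * Suc k)" by (simp add: f_def)
      with 3 show ?thesis by (simp only: comp_apply mix_odd fun_upd_apply nat.case p'_def) simp
    qed (simp add: f_def mix_def)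
  qed
  have "(\<forall>x. P (s \<circ> \<tau>) x) \<longleftrightarrow> sat E (mix s p') (All 1 (rename f \<phi>))" for s
    using * by (simp add: \<phi> sat_rename inj)
  then show "\<exists>\<phi> p. \<forall>s. (\<forall>x. P (s \<circ> \<tau>) x) \<longleftrightarrow> sat E (mix s p) \<phi>" by blast
qed

lemma definable_disj [definable_intros]:
  assumes "definable P" "definable P'" shows "definable (\<lambda>s. P s \<or> P' s)"
proof -
  have "definable (\<lambda>s. \<not> (\<not> P s \<and> \<not> P' s))" by (intro definable_not definable_conj assms)
  then show ?thesis by simp
qed

lemma definable_imp [definable_intros]:
  assumes "definable P" "definable P'" shows "definable (\<lambda>s. P s \<longrightarrow> P' s)"
  unfolding imp_conv_disj by (intro definable_not definable_disj assms)

lemma definable_iff [definable_intros]: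
  assumes "definable P" "definable P'" shows "definable (\<lambda>s. P s \<longleftrightarrow> P' s)"
  unfolding iff_conv_conj_imp by (intro definable_conj definable_imp assms)

lemma definable_ex [definable_intros]:
  assumes "definable (\<lambda>s. P (\<lambda>i. s (Suc i)) (s 0))" shows "definable (\<lambda>s. \<exists>x. P s x)"
proof -
  have "definable (\<lambda>s. \<not> (\<forall>x. \<not> P s x))" by (intro definable_not definable_all assms)
  then show ?thesis by simp
qed

lemma definable_fun_var [definable_intros]: "definable_fun (\<lambda>s. s i)"
  unfolding definable_fun_def by (rule definable_eq_var)

lemma definable_fun_const [definable_intros]: "definable_fun (\<lambda>s. c)"
  unfolding definable_fun_def by (rule definable_eq_const)

text \<open>
  Compound terms are inserted by quantifying over their values, so that only variables are ever
  substituted into a formula.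
\<close>

lemma definable_subst1:
  assumes "definable (\<lambda>s. R (s 0))" "definable_fun f"
  shows "definable (\<lambda>s. R (f s))"
proof -
  have "definable (\<lambda>s. \<exists>x. x = f s \<and> R x)"
    by (intro definable_ex definable_conj assms(1)) (use assms(2) in \<open>simp add: definable_fun_def\<close>)
  then show ?thesis by simp
qed

lemma definable_subst2:
  assumes "definable (\<lambda>s. R (s 0) (s 1))" "definable_fun f" "definable_fun g"
  shows "definable (\<lambda>s. R (f s) (g s))"
proof -
  have "definable (\<lambda>s. s 1 = f (\<lambda>i. s (Suc (Suc i))))"
    using definable_reindex[OF assms(2)[unfolded definable_fun_def], of "case_nat 1 (\<lambda>i. Suc (Suc i))"]
    by simp
  moreover have "definable (\<lambda>s. s 0 = g (\<lambda>i. s (Suc (Suc i))))"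
    using definable_reindex[OF assms(3)[unfolded definable_fun_def], of "case_nat 0 (\<lambda>i. Suc (Suc i))"]
    by simp
  moreover have "definable (\<lambda>s. R (s 1) (s 0))"
    using definable_reindex[OF assms(1), of "case_nat 1 (\<lambda>i. 0)"] by simp
  ultimately have "definable (\<lambda>s. \<exists>x y. x = f s \<and> y = g s \<and> R x y)"
    by (intro definable_ex definable_conj) simp_all
  then show ?thesis by simp
qed

lemma definable_mem [definable_intros]:
  "definable_fun f \<Longrightarrow> definable_fun g \<Longrightarrow> definable (\<lambda>s. E (f s) (g s))"
  by (rule definable_subst2[of E, OF definable_mem_var])

lemma definable_eq [definable_intros]:
  "definable_fun f \<Longrightarrow> definable_fun g \<Longrightarrow> definable (\<lambda>s. f s = g s)"
  by (rule definable_subst2[of "(=)", OF definable_eq_var])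

lemma definable_fun_subst1:
  assumes "definable (\<lambda>s. s 0 = F (s 1))" "definable_fun f"
  shows "definable_fun (\<lambda>s. F (f s))"
proof -
  have "definable (\<lambda>s. \<exists>x. x = f (\<lambda>i. s (Suc i)) \<and> s 0 = F x)"
    using definable_reindex[OF assms(2)[unfolded definable_fun_def], of "case_nat 0 (\<lambda>i. Suc (Suc i))"]
      definable_reindex[OF assms(1), of "case_nat 1 (\<lambda>i. 0)"]
    by (intro definable_ex definable_conj) simp_all
  then show ?thesis by (simp add: definable_fun_def)
qed

lemma definable_fun_subst2:
  assumes "definable (\<lambda>s. s 0 = F (s 1) (s 2))" "definable_fun f" "definable_fun g"
  shows "definable_fun (\<lambda>s. F (f s) (g s))"
proof -
  have "definable (\<lambda>s. s 1 = f (\<lambda>i. s (Suc (Suc (Suc i)))))"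
    using definable_reindex[OF assms(2)[unfolded definable_fun_def], of "case_nat 1 (\<lambda>i. Suc (Suc (Suc i)))"]
    by simp
  moreover have "definable (\<lambda>s. s 0 = g (\<lambda>i. s (Suc (Suc (Suc i)))))"
    using definable_reindex[OF assms(3)[unfolded definable_fun_def], of "case_nat 0 (\<lambda>i. Suc (Suc (Suc i)))"]
    by simp
  moreover have "definable (\<lambda>s. s 2 = F (s 1) (s 0))"
    using definable_reindex[OF assms(1), of "case_nat 2 (case_nat 1 (\<lambda>i. 0))"] by (simp add: numeral_2_eq_2)
  ultimately have "definable (\<lambda>s. \<exists>x y. x = f (\<lambda>i. s (Suc i)) \<and> y = g (\<lambda>i. s (Suc i)) \<and> s 0 = F x y)"
    by (intro definable_ex definable_conj) (simp_all add: numeral_2_eq_2)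
  then show ?thesis by (simp add: definable_fun_def)
qed

abbreviation internal where "internal \<equiv> internal_set E"

lemma definable_in [definable_intros]:
  assumes "internal A" "definable_fun f" shows "definable (\<lambda>s. f s \<in> A)"
  using assms by (auto simp: internal_set_def intro!: definable_intros)

lemma definable_ball [definable_intros]:
  assumes "internal A" "definable (\<lambda>s. P (\<lambda>i. s (Suc i)) (s 0))"
  shows "definable (\<lambda>s. \<forall>x\<in>A. P s x)"
  unfolding Ball_def by (intro definable_intros assms)

lemma definable_bex [definable_intros]:
  assumes "internal A" "definable (\<lambda>s. P (\<lambda>i. s (Suc i)) (s 0))"
  shows "definable (\<lambda>s. \<exists>x\<in>A. P s x)"
  unfolding Bex_def by (intro definable_intros assms)

section \<open>Basic set theory of the model\<close>

lemma internal_Collect_mem: "internal {x. E x a}"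
  by (auto simp: internal_set_def)

lemma internal_separation:
  assumes "internal A" "definable (\<lambda>s. P (s 0))"
  shows "internal {x \<in> A. P x}"
proof -
  obtain a where a: "A = {x. E x a}" using assms(1) by (auto simp: internal_set_def)
  obtain \<phi> p where \<phi>: "\<forall>s. P ((s \<circ> id) 0) \<longleftrightarrow> sat E (mix s p) \<phi>"
    using assms(2) unfolding definable_def by blast
  define d :: "nat \<Rightarrow> 'm" where "d = undefined"
  have "mix (d(0 := x)) p = (mix d p)(0 := x)" for x
    by (auto simp: fun_eq_iff mix_def elim!: evenE)
  then have "P x \<longleftrightarrow> sat E ((mix d p)(0 := x)) \<phi>" for x
    using \<phi>[rule_format, of "d(0 := x)"] by simp
  then obtain c where "\<forall>x. E x c \<longleftrightarrow> E x a \<and> P x"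
    using separation[of a "mix d p" \<phi>] by auto
  then show ?thesis unfolding internal_set_def a by (intro exI[of _ c]) auto
qed

lemma mem_upair: "E z (upair E x y) \<longleftrightarrow> z = x \<or> z = y"
proof -
  have "\<exists>!p. \<forall>z. E z p \<longleftrightarrow> z = x \<or> z = y"
    using pairing[of x y] by (auto intro: extensionality)
  from theI'[OF this] show ?thesis unfolding upair_def by blast
qed

lemma upair_eq_iff: "upair E x y = upair E x' y' \<longleftrightarrow> (x = x' \<and> y = y') \<or> (x = y' \<and> y = x')"
proof
  assume "upair E x y = upair E x' y'"
  then have "z = x \<or> z = y \<longleftrightarrow> z = x' \<or> z = y'" for z using mem_upair[of z] by metis
  then show "(x = x' \<and> y = y') \<or> (x = y' \<and> y = x')" by metis
qed (auto intro: extensionality simp: mem_upair)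

lemma opair_eq_iff [simp]: "opair E x y = opair E x' y' \<longleftrightarrow> x = x' \<and> y = y'"
  unfolding opair_def upair_eq_iff by auto

lemma eq_upair_iff: "p = upair E x y \<longleftrightarrow> (\<forall>z. E z p \<longleftrightarrow> z = x \<or> z = y)"
  using mem_upair by (auto intro: extensionality)

lemma definable_fun_upair:
  "definable_fun f \<Longrightarrow> definable_fun g \<Longrightarrow> definable_fun (\<lambda>s. upair E (f s) (g s))"
  by (rule definable_fun_subst2) (unfold eq_upair_iff, intro definable_intros)

lemma definable_fun_opair [definable_intros]:
  "definable_fun f \<Longrightarrow> definable_fun g \<Longrightarrow> definable_fun (\<lambda>s. opair E (f s) (g s))"
  unfolding opair_def by (intro definable_fun_upair)

lemma mem_succ_set: "E x (succ_set E n) \<longleftrightarrow> E x n \<or> x = n"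
proof -
  obtain u where u: "\<forall>x. E x u \<longleftrightarrow> (\<exists>y. E y (upair E n (upair E n n)) \<and> E x y)"
    using union by blast
  then have "\<forall>x. E x u \<longleftrightarrow> E x n \<or> x = n" by (auto simp: mem_upair)
  then have "\<exists>!m. \<forall>x. E x m \<longleftrightarrow> E x n \<or> x = n" by (auto intro: extensionality)
  from theI'[OF this] show ?thesis unfolding succ_set_def by blast
qed

lemma eq_succ_set_iff: "m = succ_set E n \<longleftrightarrow> (\<forall>x. E x m \<longleftrightarrow> E x n \<or> x = n)"
  using mem_succ_set by (auto intro: extensionality)

lemma definable_fun_succ_set [definable_intros]: "definable_fun f \<Longrightarrow> definable_fun (\<lambda>s. succ_set E (f s))"
  by (rule definable_fun_subst1) (unfold eq_succ_set_iff, intro definable_intros)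

lemma not_mem_empty: "\<not> E x (empty_set E)"
proof -
  obtain z where "\<forall>x. \<not> E x z" using infinity unfolding is_inductive_def by blast
  then have "\<exists>!z. \<forall>x. \<not> E x z" by (auto intro: extensionality)
  from theI'[OF this] show ?thesis unfolding empty_set_def by blast
qed

lemma is_inductive_iff:
  "is_inductive E a \<longleftrightarrow> E (empty_set E) a \<and> (\<forall>n. E n a \<longrightarrow> E (succ_set E n) a)"
proof -
  have "(\<forall>x. \<not> E x z) \<longleftrightarrow> z = empty_set E" for z
    using not_mem_empty by (auto intro: extensionality)
  then show ?thesis unfolding is_inductive_def eq_succ_set_iff[symmetric] by auto
qed

lemma internal_omega: "internal (omega E)"
proof -
  obtain a where a: "is_inductive E a" using infinity by blast
  have "omega E = {n \<in> {x. E x a}. \<forall>a. is_inductive E a \<longrightarrow> E n a}"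
    using a by (auto simp: omega_def)
  also have "internal \<dots>"
    unfolding is_inductive_iff by (intro internal_separation internal_Collect_mem definable_intros)
  finally show ?thesis .
qed

lemma empty_in_omega: "empty_set E \<in> omega E"
  and succ_in_omega: "n \<in> omega E \<Longrightarrow> succ_set E n \<in> omega E"
  by (auto simp: omega_def is_inductive_iff)

text \<open>
  Induction in the model holds only for internal predicates; a nonstandard \<open>\<omega>\<close> has HOL subsets that contain
  zero, are closed under successor and are proper.
\<close>

lemma omega_induct [consumes 1, case_names definable empty succ]:
  assumes "n \<in> omega E" "definable (\<lambda>s. P (s 0))" "P (empty_set E)"
    "\<And>n. n \<in> omega E \<Longrightarrow> P n \<Longrightarrow> P (succ_set E n)"
  shows "P n"
proof -
  have "internal {n \<in> omega E. P n}" by (intro internal_separation internal_omega assms)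
  then obtain a where a: "{n \<in> omega E. P n} = {n. E n a}" by (auto simp: internal_set_def)
  have "is_inductive E a" unfolding is_inductive_iff
    using a assms(3,4) empty_in_omega succ_in_omega by blast
  with assms(1) have "E n a" by (simp add: omega_def)
  with a show ?thesis by blast
qed

lemma internal_Un:
  assumes "internal A" "internal B" shows "internal (A \<union> B)"
proof -
  obtain a b where ab: "A = {x. E x a}" "B = {x. E x b}" using assms by (auto simp: internal_set_def)
  obtain u where "\<forall>x. E x u \<longleftrightarrow> (\<exists>y. E y (upair E a b) \<and> E x y)" using union by blast
  then show ?thesis unfolding internal_set_def ab by (intro exI[of _ u]) (auto simp: mem_upair)
qed

lemma internal_Pow:
  assumes "internal A" shows "internal {y. \<forall>x. E x y \<longrightarrow> x \<in> A}"
proof -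
  obtain a where "A = {x. E x a}" using assms by (auto simp: internal_set_def)
  then show ?thesis using power_set[of a] by (auto simp: internal_set_def)
qed

text \<open>
  A Kuratowski pair of members of \<open>A\<close> and \<open>B\<close> is a set of subsets of \<open>A \<union> B\<close>, so two power sets and
  separation suffice.
\<close>

lemma internal_product:
  assumes "internal A" "internal B"
  shows "internal {opair E x y | x y. x \<in> A \<and> y \<in> B}"
proof -
  define D where "D = {p. \<forall>q. E q p \<longrightarrow> q \<in> {y. \<forall>x. E x y \<longrightarrow> x \<in> A \<union> B}}"
  have "internal D" unfolding D_def by (intro internal_Pow internal_Un assms)
  then have "internal {p \<in> D. \<exists>x\<in>A. \<exists>y\<in>B. p = opair E x y}"
    by (intro internal_separation definable_intros assms)
  also have "{p \<in> D. \<exists>x\<in>A. \<exists>y\<in>B. p = opair E x y} = {opair E x y | x y. x \<in> A \<and> y \<in> B}"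
    by (auto simp: D_def opair_def mem_upair)
  finally show ?thesis .
qed

lemma internal_relation:
  assumes "internal A" "internal B" "definable (\<lambda>s. R (s 0) (s 1))"
  shows "internal {opair E x y | x y. x \<in> A \<and> y \<in> B \<and> R x y}"
proof -
  have "internal {p \<in> {opair E x y | x y. x \<in> A \<and> y \<in> B}. \<exists>x y. p = opair E x y \<and> R x y}"
    by (intro internal_separation internal_product assms definable_intros definable_subst2[OF assms(3)])
  also have "{p \<in> {opair E x y | x y. x \<in> A \<and> y \<in> B}. \<exists>x y. p = opair E x y \<and> R x y}
    = {opair E x y | x y. x \<in> A \<and> y \<in> B \<and> R x y}" by auto
  finally show ?thesis .
qed

text \<open>
  The operations of a ring or module record are arbitrary HOL functions outside the carriers, hence need not be
  definable there. A constant value outside makes them definable as total functions, so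
  that terms built from them can be treated compositionally.
\<close>

definition total2 :: "'m set \<Rightarrow> 'm set \<Rightarrow> ('m \<Rightarrow> 'm \<Rightarrow> 'm) \<Rightarrow> 'm \<Rightarrow> 'm \<Rightarrow> 'm" where
  "total2 A B f x y = (if x \<in> A \<and> y \<in> B then f x y else undefined)"

lemma total2_eq [simp]: "x \<in> A \<Longrightarrow> y \<in> B \<Longrightarrow> total2 A B f x y = f x y"
  by (simp add: total2_def)

lemma definable_fun_total2:
  assumes "internal_fun2 E A B C F" "internal A" "internal B" "definable_fun f" "definable_fun g"
  shows "definable_fun (\<lambda>s. total2 A B F (f s) (g s))"
proof (rule definable_fun_subst2[OF _ assms(4,5)])
  let ?G = "{opair E (opair E x y) (F x y) | x y. x \<in> A \<and> y \<in> B}"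
  have "internal ?G" using assms(1) by (simp add: internal_fun2_def)
  then have "definable (\<lambda>s. s 1 \<in> A \<and> s 2 \<in> B \<and> opair E (opair E (s 1) (s 2)) (s 0) \<in> ?G
    \<or> \<not> (s 1 \<in> A \<and> s 2 \<in> B) \<and> s 0 = undefined)"
    by (intro definable_intros assms)
  moreover have "(s 1 \<in> A \<and> s 2 \<in> B \<and> opair E (opair E (s 1) (s 2)) (s 0) \<in> ?G
    \<or> \<not> (s 1 \<in> A \<and> s 2 \<in> B) \<and> s 0 = undefined) \<longleftrightarrow> s 0 = total2 A B F (s 1) (s 2)" for s :: "nat \<Rightarrow> 'm"
    by (auto simp: total2_def)
  ultimately show "definable (\<lambda>s. s 0 = total2 A B F (s 1) (s 2))" by simp
qed

end

section \<open>The rationals of the model\<close>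

locale internal_rationals = ZF_model E + field Q for E :: "'m \<Rightarrow> 'm \<Rightarrow> bool" and Q :: "'m ring" (structure) +
  fixes j :: "'m \<Rightarrow> 'm"
  assumes internal_Q [definable_intros]: "internal (carrier Q)"
    and internal_addQ: "internal_fun2 E (carrier Q) (carrier Q) (carrier Q) (add Q)"
    and internal_multQ: "internal_fun2 E (carrier Q) (carrier Q) (carrier Q) (mult Q)"
    and internal_j: "internal_fun E (omega E) (carrier Q) j"
    and inj_j: "inj_on j (omega E)"
    and j_empty: "j (empty_set E) = \<zero>"
    and j_succ: "n \<in> omega E \<Longrightarrow> j (succ_set E n) = j n \<oplus> \<one>"
    and j_quotient: "q \<in> carrier Q \<Longrightarrow> \<exists>a\<in>omega E. \<exists>b\<in>omega E. \<exists>d\<in>omega E.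
           j d \<noteq> \<zero> \<and> q = (j a \<ominus> j b) \<otimes> inv (j d)"
begin

abbreviation addQ where "addQ \<equiv> total2 (carrier Q) (carrier Q) (add Q)"
abbreviation multQ where "multQ \<equiv> total2 (carrier Q) (carrier Q) (mult Q)"

lemmas definable_fun_addQ [definable_intros] = definable_fun_total2[OF internal_addQ internal_Q internal_Q]
lemmas definable_fun_multQ [definable_intros] = definable_fun_total2[OF internal_multQ internal_Q internal_Q]

text \<open>
  Working with the image of \<open>\<omega>\<close> in the field avoids the recursive definition of arithmetic on \<open>\<omega>\<close>.
\<close>

definition naturals :: "'m set" where "naturals = j ` omega E"

lemma naturals_closed [simp, intro]: "x \<in> naturals \<Longrightarrow> x \<in> carrier Q"
  using internal_j by (auto simp: naturals_def internal_fun_def)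

lemma definable_graph_j:
  assumes "definable_fun f" "definable_fun g"
  shows "definable (\<lambda>s. f s \<in> omega E \<and> g s = j (f s))"
proof -
  have "internal {opair E x (j x) | x. x \<in> omega E}" using internal_j by (simp add: internal_fun_def)
  then have "definable (\<lambda>s. opair E (f s) (g s) \<in> {opair E x (j x) | x. x \<in> omega E})"
    by (intro definable_intros assms)
  also have "(\<lambda>s. opair E (f s) (g s) \<in> {opair E x (j x) | x. x \<in> omega E})
    = (\<lambda>s. f s \<in> omega E \<and> g s = j (f s))" by auto
  finally show ?thesis .
qed

lemma internal_naturals [definable_intros]: "internal naturals"
proof -
  have "internal {x \<in> carrier Q. \<exists>n. n \<in> omega E \<and> x = j n}"
    by (intro internal_separation internal_Q definable_intros definable_graph_j)
  moreover have "{x \<in> carrier Q. \<exists>n. n \<in> omega E \<and> x = j n} = naturals"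
    using internal_j by (auto simp: naturals_def internal_fun_def)
  ultimately show ?thesis by simp
qed

lemma zero_natural [simp, intro]: "\<zero> \<in> naturals"
  using empty_in_omega j_empty by (auto simp: naturals_def intro: rev_image_eqI)

lemma succ_natural [intro]: "x \<in> naturals \<Longrightarrow> x \<oplus> \<one> \<in> naturals"
  using succ_in_omega j_succ by (force simp: naturals_def image_iff)

lemma naturals_induct [consumes 1, case_names definable zero succ]:
  assumes "x \<in> naturals" "definable (\<lambda>s. R (s 0))" "R \<zero>"
    "\<And>x. x \<in> naturals \<Longrightarrow> R x \<Longrightarrow> R (x \<oplus> \<one>)"
  shows "R x"
proof -
  obtain n where n: "n \<in> omega E" "x = j n" using assms(1) by (auto simp: naturals_def)
  have "\<exists>y. (n \<in> omega E \<and> y = j n) \<and> R y" using n(1)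
  proof (induction rule: omega_induct)
    case definable
    show ?case by (intro definable_intros definable_graph_j definable_subst1[of R, OF assms(2)])
  next
    case empty
    show ?case using assms(3) empty_in_omega j_empty by auto
  next
    case (succ n)
    then have "R (j n \<oplus> \<one>)" using assms(4)[of "j n"] by (auto simp: naturals_def)
    then show ?case using succ succ_in_omega j_succ by auto
  qed
  with n show ?thesis by simp
qed

lemma naturals_add [simp, intro]:
  assumes "x \<in> naturals" "y \<in> naturals" shows "x \<oplus> y \<in> naturals"
proof -
  have "addQ x y \<in> naturals" using assms(2)
  proof (induction rule: naturals_induct)
    case definable show ?case by (intro definable_intros)
  next
    case zero show ?case using assms by simp
  next
    case (succ y)
    then have "x \<oplus> (y \<oplus> \<one>) = (x \<oplus> y) \<oplus> \<one>" using assms by (simp add: a_assoc)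
    then show ?case using succ assms succ_natural[of "x \<oplus> y"] by simp
  qed
  then show ?thesis using assms by simp
qed

lemma naturals_mult [simp, intro]:
  assumes "x \<in> naturals" "y \<in> naturals" shows "x \<otimes> y \<in> naturals"
proof -
  have "multQ x y \<in> naturals" using assms(2)
  proof (induction rule: naturals_induct)
    case definable show ?case by (intro definable_intros)
  next
    case zero show ?case using assms by simp
  next
    case (succ y)
    then have "x \<otimes> (y \<oplus> \<one>) = x \<otimes> y \<oplus> x" using assms by (simp add: r_distr)
    then show ?case using succ assms by simp
  qed
  then show ?thesis using assms by simp
qed

lemma one_natural [simp, intro]: "\<one> \<in> naturals"
  using succ_natural[OF zero_natural] by simp

lemma succ_not_zero:
  assumes "x \<in> naturals" shows "x \<oplus> \<one> \<noteq> \<zero>"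
proof
  assume *: "x \<oplus> \<one> = \<zero>"
  obtain n where n: "n \<in> omega E" "x = j n" using assms by (auto simp: naturals_def)
  have "j (succ_set E n) = j (empty_set E)" using * n j_succ j_empty by simp
  then have "succ_set E n = empty_set E"
    using inj_j n succ_in_omega empty_in_omega by (auto dest: inj_onD)
  then show False using mem_succ_set[of n n] not_mem_empty by simp
qed

lemma naturals_cases:
  assumes "x \<in> naturals" obtains "x = \<zero>" | y where "y \<in> naturals" "x = y \<oplus> \<one>"
proof -
  have "x = \<zero> \<or> (\<exists>y\<in>naturals. x = addQ y \<one>)" using assms
  proof (induction rule: naturals_induct)
    case definable show ?case by (intro definable_intros)
  qed auto
  with that show thesis by auto
qed

lemma naturals_add_eq_zero:
  assumes "x \<in> naturals" "y \<in> naturals" "x \<oplus> y = \<zero>" shows "x = \<zero>" "y = \<zero>"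
proof -
  show "y = \<zero>" using assms(2)
  proof (cases rule: naturals_cases)
    case (2 z)
    then have "(x \<oplus> z) \<oplus> \<one> = \<zero>" using assms by (simp add: a_assoc)
    then show ?thesis using succ_not_zero[of "x \<oplus> z"] 2 assms by auto
  qed
  then show "x = \<zero>" using assms by simp
qed

definition le :: "'m \<Rightarrow> 'm \<Rightarrow> bool" where "le x y \<longleftrightarrow> (\<exists>z\<in>naturals. y = addQ x z)"

lemma le_iff: "x \<in> naturals \<Longrightarrow> le x y \<longleftrightarrow> (\<exists>z\<in>naturals. y = x \<oplus> z)"
  by (auto simp: le_def)

lemma definable_le [definable_intros]: "definable_fun f \<Longrightarrow> definable_fun g \<Longrightarrow> definable (\<lambda>s. le (f s) (g s))"
  by (rule definable_subst2) (unfold le_def, intro definable_intros)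

lemma le_zero: "x \<in> naturals \<Longrightarrow> le \<zero> x"
  by (auto simp: le_iff)

lemma le_antisym:
  assumes "x \<in> naturals" "y \<in> naturals" "le x y" "le y x" shows "x = y"
proof -
  obtain a b where ab: "a \<in> naturals" "b \<in> naturals" "y = x \<oplus> a" "x = y \<oplus> b"
    using assms by (auto simp: le_iff)
  then have "x \<oplus> (a \<oplus> b) = x" using assms by (metis a_assoc naturals_closed)
  then have "a \<oplus> b = \<zero>" using ab(1,2) assms(1) by simp
  then show ?thesis using naturals_add_eq_zero(1)[of a b] ab assms by simp
qed

lemma le_succ_or_eq:
  assumes "x \<in> naturals" "y \<in> naturals" "le x y" "x \<noteq> y" shows "le (x \<oplus> \<one>) y"
proof -
  obtain z where z: "z \<in> naturals" "y = x \<oplus> z" using assms by (auto simp: le_iff)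
  from z(1) show ?thesis
  proof (cases rule: naturals_cases)
    case 1 then show ?thesis using z assms by simp
  next
    case (2 w)
    then have "y = (x \<oplus> \<one>) \<oplus> w" using z assms by (simp add: a_assoc a_comm[of w])
    then show ?thesis using 2 assms by (auto simp: le_iff succ_natural)
  qed
qed

lemma not_succ_le: "x \<in> naturals \<Longrightarrow> \<not> le (x \<oplus> \<one>) x"
proof
  assume x: "x \<in> naturals" and "le (x \<oplus> \<one>) x"
  then obtain z where z: "z \<in> naturals" "x = (x \<oplus> \<one>) \<oplus> z" by (auto simp: le_iff succ_natural)
  then have "x \<oplus> (z \<oplus> \<one>) = x" using x by (metis a_assoc a_comm naturals_closed one_closed)
  then have "z \<oplus> \<one> = \<zero>" using x z(1) by simp
  then show False using succ_not_zero z by simp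
qed

lemma le_refl: "x \<in> naturals \<Longrightarrow> le x x"
  using r_zero by (force simp: le_iff)

lemma le_trans: 
  assumes "x \<in> naturals" "y \<in> naturals" "le x y" "le y z" shows "le x z"
proof -
  obtain a b where "a \<in> naturals" "b \<in> naturals" "y = x \<oplus> a" "z = y \<oplus> b"
    using assms by (auto simp: le_iff)
  then have "z = x \<oplus> (a \<oplus> b)" using assms by (simp add: a_assoc)
  then show ?thesis using \<open>a \<in> naturals\<close> \<open>b \<in> naturals\<close> assms by (auto simp: le_iff)
qed

lemma le_linear:
  assumes "x \<in> naturals" "y \<in> naturals" shows "le x y \<or> le y x"
  using assms(2)
proof (induction rule: naturals_induct)
  case definable show ?case by (intro definable_intros)
next
  case zero show ?case using assms le_zero by simp
next
  case (succ y)
  have y: "le y (y \<oplus> \<one>)" using succ by (auto simp: le_iff)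
  show ?case
  proof (cases "le x y")
    case True then show ?thesis using y le_trans[of x y] succ assms by blast
  next
    case False then show ?thesis
      using succ assms le_succ_or_eq[of y x] le_refl[of x] by (cases "x = y") auto
  qed
qed

text \<open>
  If no element of \<open>X\<close> were least, then by induction every natural number would be a lower bound of \<open>X\<close>,
  including \<open>x + 1\<close>.
\<close>

lemma naturals_least:
  assumes "internal X" "X \<subseteq> naturals" "x \<in> X"
  shows "\<exists>m\<in>X. \<forall>y\<in>X. le m y"
proof (rule ccontr)
  assume *: "\<not> ?thesis"
  have "\<forall>y\<in>X. le n y" if "n \<in> naturals" for n using that
  proof (induction rule: naturals_induct)
    case definable show ?case by (intro definable_intros assms)
  next
    case zero show ?case using assms le_zero by blast
  next
    case (succ n)
    then have "n \<notin> X" using * by blast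
    then show ?case using succ assms le_succ_or_eq by (metis subsetD)
  qed
  then have "le (x \<oplus> \<one>) x" using assms by (meson subsetD succ_natural)
  then show False using not_succ_le assms by blast
qed

text \<open>
  A polynomial pairing function: \<open>(a + d)\<^sup>2\<close> is the largest square of a natural number that does not
  exceed the code, because \<open>a < 2 (a + d) + 1\<close>.
\<close>

definition code :: "'m \<Rightarrow> 'm \<Rightarrow> 'm" where
  "code a d = addQ (multQ (addQ a d) (addQ a d)) a"

lemma code_eq: "a \<in> naturals \<Longrightarrow> d \<in> naturals \<Longrightarrow> code a d = (a \<oplus> d) \<otimes> (a \<oplus> d) \<oplus> a"
  by (simp add: code_def)

lemma definable_fun_code [definable_intros]:
  "definable_fun f \<Longrightarrow> definable_fun g \<Longrightarrow> definable_fun (\<lambda>s. code (f s) (g s))"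
  unfolding code_def by (intro definable_intros)

lemma code_natural: "a \<in> naturals \<Longrightarrow> d \<in> naturals \<Longrightarrow> code a d \<in> naturals"
  by (simp add: code_eq)

text \<open>
  If the second sum were \<open>s + t\<close> with \<open>s = a + d\<close> and \<open>t > 0\<close>, its square would exceed \<open>s\<^sup>2\<close> by \<open>s t + t (s + t)\<close>, where
  \<open>s t \<ge> s \<ge> a\<close> and \<open>t (s + t) > 0\<close>. The second code would then be larger than the first.
\<close>

lemma code_sum_le:
  assumes "a \<in> naturals" "d \<in> naturals" "a' \<in> naturals" "d' \<in> naturals" "code a d = code a' d'"
    "le (a \<oplus> d) (a' \<oplus> d')"
  shows "a \<oplus> d = a' \<oplus> d'"
proof (rule ccontr)
  assume "a \<oplus> d \<noteq> a' \<oplus> d'"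
  then have "le (a \<oplus> d \<oplus> \<one>) (a' \<oplus> d')" using assms by (simp add: le_succ_or_eq)
  then obtain z where z: "z \<in> naturals" "a' \<oplus> d' = a \<oplus> d \<oplus> \<one> \<oplus> z" using assms by (auto simp: le_iff)
  define s t where "s = a \<oplus> d" and "t = z \<oplus> \<one>"
  have st: "s \<in> naturals" "t \<in> naturals" "t \<noteq> \<zero>"
    using assms z succ_not_zero by (auto simp: s_def t_def)
  have "a' \<oplus> d' = s \<oplus> t" using z assms by (simp add: s_def t_def a_ac)
  then have "s \<otimes> s \<oplus> a = (s \<oplus> t) \<otimes> (s \<oplus> t) \<oplus> a'"
    using assms(5) assms(1-4) by (simp add: code_eq s_def)
  also have "(s \<oplus> t) \<otimes> (s \<oplus> t) = s \<otimes> s \<oplus> (s \<otimes> t \<oplus> t \<otimes> (s \<oplus> t))"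
    using naturals_closed[OF st(1)] naturals_closed[OF st(2)] by algebra
  also have "s \<otimes> t = s \<otimes> z \<oplus> (a \<oplus> d)" using st z by (simp add: t_def r_distr flip: s_def)
  also have "s \<otimes> s \<oplus> (s \<otimes> z \<oplus> (a \<oplus> d) \<oplus> t \<otimes> (s \<oplus> t)) \<oplus> a'
      = (s \<otimes> s \<oplus> a) \<oplus> (t \<otimes> (s \<oplus> t) \<oplus> (s \<otimes> z \<oplus> d \<oplus> a'))"
    using assms(1-4) st z(1) by (simp add: a_ac)
  finally have "t \<otimes> (s \<oplus> t) \<oplus> (s \<otimes> z \<oplus> d \<oplus> a') = \<zero>" using assms st z by simp
  from naturals_add_eq_zero(1)[OF _ _ this] have "t \<otimes> (s \<oplus> t) = \<zero>" using assms(1-4) st(1,2) z(1) by simp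
  then have "s \<oplus> t = \<zero>" using integral[of t "s \<oplus> t"] st by simp
  then show False using naturals_add_eq_zero(2)[of s t] st by simp
qed

lemma code_inject:
  assumes "a \<in> naturals" "d \<in> naturals" "a' \<in> naturals" "d' \<in> naturals" "code a d = code a' d'"
  shows "a = a'" "d = d'"
proof -
  have s: "a \<oplus> d = a' \<oplus> d'"
    using code_sum_le[of a d a' d'] code_sum_le[of a' d' a d] le_linear[of "a \<oplus> d" "a' \<oplus> d'"] assms
    by auto
  have "(a' \<oplus> d') \<otimes> (a' \<oplus> d') \<oplus> a = (a' \<oplus> d') \<otimes> (a' \<oplus> d') \<oplus> a'"
    using assms(5) assms(1-4) s by (simp add: code_eq)
  then show "a = a'" using assms(1-4)
    by (metis add.right_cancel a_comm naturals_closed naturals_add naturals_mult)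
  with s show "d = d'" using assms(1-4)
    by (metis add.right_cancel a_comm naturals_closed)
qed

definition nonneg :: "'m set" where
  "nonneg = {x \<in> carrier Q. \<exists>a\<in>naturals. \<exists>d\<in>naturals. d \<noteq> \<zero> \<and> multQ x d = a}"

lemma nonnegI: "x \<in> carrier Q \<Longrightarrow> d \<in> naturals \<Longrightarrow> d \<noteq> \<zero> \<Longrightarrow> x \<otimes> d \<in> naturals \<Longrightarrow> x \<in> nonneg"
  unfolding nonneg_def by auto

lemma nonnegE:
  assumes "x \<in> nonneg"
  obtains d where "x \<in> carrier Q" "d \<in> naturals" "d \<noteq> \<zero>" "x \<otimes> d \<in> naturals"
  using assms unfolding nonneg_def by auto

lemma nonneg_closed [simp, intro]: "x \<in> nonneg \<Longrightarrow> x \<in> carrier Q"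
  by (simp add: nonneg_def)

lemma internal_nonneg [definable_intros]: "internal nonneg"
  unfolding nonneg_def by (intro internal_separation definable_intros)

lemma nonneg_zero: "\<zero> \<in> nonneg"
  by (rule nonnegI[of _ \<one>]) auto

text \<open>
  Fractions are compared after multiplication by a common denominator, which reduces the next two lemmas to
  natural numbers.
\<close>

lemma common_denominator:
  assumes "x \<in> nonneg" "y \<in> nonneg"
  obtains d where "d \<in> naturals" "d \<noteq> \<zero>" "x \<otimes> d \<in> naturals" "y \<otimes> d \<in> naturals"
proof -
  obtain d where d: "x \<in> carrier Q" "d \<in> naturals" "d \<noteq> \<zero>" "x \<otimes> d \<in> naturals"
    using assms(1) by (rule nonnegE)
  obtain e where e: "y \<in> carrier Q" "e \<in> naturals" "e \<noteq> \<zero>" "y \<otimes> e \<in> naturals"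
    using assms(2) by (rule nonnegE)
  show thesis
  proof (rule that)
    show "d \<otimes> e \<in> naturals" using d e by simp
    show "d \<otimes> e \<noteq> \<zero>" using d e integral[of d e] by auto
    have "x \<otimes> (d \<otimes> e) = (x \<otimes> d) \<otimes> e" using d e by (simp add: m_assoc)
    then show "x \<otimes> (d \<otimes> e) \<in> naturals" using d e by simp
    have "y \<otimes> (d \<otimes> e) = (y \<otimes> e) \<otimes> d" using d e by (simp add: m_assoc m_comm[of d])
    then show "y \<otimes> (d \<otimes> e) \<in> naturals" using d e by simp
  qed
qed

lemma nonneg_add: assumes "x \<in> nonneg" "y \<in> nonneg" shows "x \<oplus> y \<in> nonneg"
proof -
  obtain d where d: "d \<in> naturals" "d \<noteq> \<zero>" "x \<otimes> d \<in> naturals" "y \<otimes> d \<in> naturals"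
    using common_denominator[OF assms] .
  have "(x \<oplus> y) \<otimes> d = x \<otimes> d \<oplus> y \<otimes> d" using d assms by (simp add: l_distr)
  then show ?thesis using d assms by (intro nonnegI[of _ d]) auto
qed

lemma nonneg_add_eq_zero:
  assumes "x \<in> nonneg" "y \<in> nonneg" "x \<oplus> y = \<zero>" shows "x = \<zero>" "y = \<zero>"
proof -
  obtain d where d: "d \<in> naturals" "d \<noteq> \<zero>" "x \<otimes> d \<in> naturals" "y \<otimes> d \<in> naturals"
    using common_denominator[OF assms(1,2)] .
  have "x \<otimes> d \<oplus> y \<otimes> d = (x \<oplus> y) \<otimes> d" using d assms(1,2) by (simp add: l_distr)
  also have "\<dots> = \<zero>" using naturals_closed[OF d(1)] by (simp add: assms(3))
  finally have "x \<otimes> d \<oplus> y \<otimes> d = \<zero>" .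
  then have "x \<otimes> d = \<zero>" "y \<otimes> d = \<zero>" using naturals_add_eq_zero[OF d(3,4)] by simp_all
  then show "x = \<zero>" "y = \<zero>" using integral[of _ d] d(1,2) assms(1,2) by auto
qed

text \<open>
  For \<open>q = (a - b) / d\<close> the number \<open>q\<^sup>2 d\<^sup>2 = (a - b)\<^sup>2\<close> is a natural number, as \<open>a - b\<close> is one up to sign.
\<close>

lemma square_nonneg: assumes "q \<in> carrier Q" shows "q \<otimes> q \<in> nonneg"
proof -
  obtain a b d where abd: "a \<in> naturals" "b \<in> naturals" "d \<in> naturals" "d \<noteq> \<zero>"
      "q = (a \<ominus> b) \<otimes> inv d"
    using j_quotient[OF assms] by (auto simp: naturals_def)
  have "inv d \<in> carrier Q" "inv d \<otimes> d = \<one>" using abd field_Units by auto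
  then have qd: "q \<otimes> d = a \<ominus> b" using abd by (simp add: m_assoc)
  have "(q \<otimes> q) \<otimes> (d \<otimes> d) = (q \<otimes> d) \<otimes> (q \<otimes> d)"
    using assms naturals_closed[OF abd(3)] by algebra
  then have eq: "(q \<otimes> q) \<otimes> (d \<otimes> d) = (a \<ominus> b) \<otimes> (a \<ominus> b)" by (simp add: qd)
  have "(a \<ominus> b) \<otimes> (a \<ominus> b) \<in> naturals" using le_linear[OF abd(1,2)]
  proof
    assume "le a b"
    then obtain z where z: "z \<in> naturals" "b = a \<oplus> z" using abd by (auto simp: le_iff)
    have "(a \<ominus> (a \<oplus> z)) \<otimes> (a \<ominus> (a \<oplus> z)) = z \<otimes> z"
      using naturals_closed[OF abd(1)] naturals_closed[OF z(1)] by algebra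
    with z show ?thesis by simp
  next
    assume "le b a"
    then obtain z where z: "z \<in> naturals" "a = b \<oplus> z" using abd by (auto simp: le_iff)
    have "((b \<oplus> z) \<ominus> b) \<otimes> ((b \<oplus> z) \<ominus> b) = z \<otimes> z"
      using naturals_closed[OF abd(2)] naturals_closed[OF z(1)] by algebra
    with z show ?thesis by simp
  qed
  moreover have "d \<otimes> d \<noteq> \<zero>" using abd(3,4) integral[of d d] by auto
  ultimately show ?thesis using eq abd assms by (intro nonnegI[of _ "d \<otimes> d"]) auto
qed

definition is_code :: "'m \<Rightarrow> 'm \<Rightarrow> bool" where
  "is_code q n \<longleftrightarrow> (\<exists>a\<in>naturals. \<exists>d\<in>naturals. d \<noteq> \<zero> \<and> multQ q d = a \<and> n = code a d)"

lemma is_code_natural: "is_code q n \<Longrightarrow> n \<in> naturals"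
  by (auto simp: is_code_def code_natural)

lemma is_code_unique:
  assumes "is_code q n" "is_code q' n" "q \<in> carrier Q" "q' \<in> carrier Q" shows "q = q'"
proof -
  obtain a d where ad: "a \<in> naturals" "d \<in> naturals" "d \<noteq> \<zero>" "q \<otimes> d = a" "n = code a d"
    using assms by (auto simp: is_code_def)
  obtain a' d' where ad': "a' \<in> naturals" "d' \<in> naturals" "d' \<noteq> \<zero>" "q' \<otimes> d' = a'" "n = code a' d'"
    using assms by (auto simp: is_code_def)
  have "a = a'" "d = d'" using code_inject[OF ad(1,2) ad'(1,2)] ad ad' by auto
  then have "q \<otimes> d = q' \<otimes> d" using ad ad' by simp
  then show ?thesis using m_rcancel[of d q q'] ad assms by auto
qed

text \<open>
  A rational number has many fractions, and the least code selects one of them without choice.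
\<close>

definition least_code :: "'m \<Rightarrow> 'm \<Rightarrow> bool" where
  "least_code q n \<longleftrightarrow> is_code q n \<and> (\<forall>m. is_code q m \<longrightarrow> le n m)"

lemma definable_is_code [definable_intros]:
  "definable_fun f \<Longrightarrow> definable_fun g \<Longrightarrow> definable (\<lambda>s. is_code (f s) (g s))"
  by (rule definable_subst2) (unfold is_code_def, intro definable_intros)

lemma definable_least_code [definable_intros]:
  "definable_fun f \<Longrightarrow> definable_fun g \<Longrightarrow> definable (\<lambda>s. least_code (f s) (g s))"
  by (rule definable_subst2) (unfold least_code_def, intro definable_intros)

lemma ex1_least_code: assumes "q \<in> nonneg" shows "\<exists>!n. least_code q n"
proof (rule ex_ex1I)
  obtain d where d: "q \<in> carrier Q" "d \<in> naturals" "d \<noteq> \<zero>" "q \<otimes> d \<in> naturals"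
    using assms by (rule nonnegE)
  then have "is_code q (code (q \<otimes> d) d)" by (auto simp: is_code_def)
  moreover have "internal {n \<in> naturals. is_code q n}"
    by (intro internal_separation definable_intros)
  ultimately show "\<exists>n. least_code q n"
    using naturals_least[of "{n \<in> naturals. is_code q n}" "code (q \<otimes> d) d"] is_code_natural
    by (auto simp: least_code_def)
qed (auto simp: least_code_def intro: le_antisym is_code_natural)

end

section \<open>The vector space and its coordinate hyperplanes\<close>

locale internal_basis = module Q V + internal_rationals E Q j
  for E :: "'m \<Rightarrow> 'm \<Rightarrow> bool" and Q :: "'m ring" (structure) and j and V :: "('m, 'm) module" +
  fixes B :: "'m set"
  assumes internal_V [definable_intros]: "internal (carrier V)"
    and internal_addV: "internal_fun2 E (carrier V) (carrier V) (carrier V) (add V)"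
    and internal_smultV: "internal_fun2 E (carrier Q) (carrier V) (carrier V) (smult V)"
    and internal_B [definable_intros]: "internal B"
    and B_subset: "B \<subseteq> carrier V"
    and B_independent: "b \<in> B \<Longrightarrow> b \<notin> span_in E Q V (B - {b})"
    and B_spanning: "span_in E Q V B = carrier V"
begin

abbreviation addV where "addV \<equiv> total2 (carrier V) (carrier V) (add V)"
abbreviation smultV where "smultV \<equiv> total2 (carrier Q) (carrier V) (smult V)"

lemmas definable_fun_addV [definable_intros] = definable_fun_total2[OF internal_addV internal_V internal_V]
lemmas definable_fun_smultV [definable_intros] = definable_fun_total2[OF internal_smultV internal_Q internal_V]

lemma B_closed [simp, intro]: "b \<in> B \<Longrightarrow> b \<in> carrier V"
  using B_subset by blast

text \<open>
  Closure under additive inverses comes from multiplication by \<open>-1\<close>. In this form being a submodule is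
  visibly definable.
\<close>

lemma submodule_iff:
  "submodule W Q V \<longleftrightarrow> W \<subseteq> carrier V \<and> \<zero>\<^bsub>V\<^esub> \<in> W \<and> (\<forall>x\<in>W. \<forall>y\<in>W. addV x y \<in> W) \<and>
    (\<forall>q\<in>carrier Q. \<forall>x\<in>W. smultV q x \<in> W)"
proof
  assume W: "submodule W Q V"
  then have "\<zero>\<^bsub>V\<^esub> \<in> W" using subgroup.one_closed[of W "add_monoid V"] by (auto simp: submodule_def)
  with submoduleE[OF W] show "W \<subseteq> carrier V \<and> \<zero>\<^bsub>V\<^esub> \<in> W \<and> (\<forall>x\<in>W. \<forall>y\<in>W. addV x y \<in> W) \<and>
    (\<forall>q\<in>carrier Q. \<forall>x\<in>W. smultV q x \<in> W)" by (auto simp: subset_iff)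
next
  assume W: "W \<subseteq> carrier V \<and> \<zero>\<^bsub>V\<^esub> \<in> W \<and> (\<forall>x\<in>W. \<forall>y\<in>W. addV x y \<in> W) \<and>
    (\<forall>q\<in>carrier Q. \<forall>x\<in>W. smultV q x \<in> W)"
  then have add: "x \<oplus>\<^bsub>V\<^esub> y \<in> W" if "x \<in> W" "y \<in> W" for x y using that total2_eq by (metis subsetD)
  from W have smult: "q \<odot>\<^bsub>V\<^esub> x \<in> W" if "q \<in> carrier Q" "x \<in> W" for q x
    using that total2_eq by (metis subsetD)
  have "\<ominus>\<^bsub>V\<^esub> x \<in> W" if "x \<in> W" for x
    using smult[of "\<ominus> \<one>" x] smult_l_minus[of \<one> x] that W by auto
  then show "submodule W Q V" using W add smult by (intro submoduleI) auto
qed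

lemma submodule_span:
  assumes "X \<subseteq> carrier V" shows "submodule (span_in E Q V X) Q V"
proof -
  have "submodule (carrier V) Q V" by (rule carrier_is_submodule)
  with assms have "span_in E Q V X \<subseteq> carrier V"
    using internal_V by (auto simp: span_in_def)
  then show ?thesis unfolding submodule_iff by (auto simp: span_in_def submodule_iff)
qed

lemma span_minimal: "internal W \<Longrightarrow> submodule W Q V \<Longrightarrow> X \<subseteq> W \<Longrightarrow> span_in E Q V X \<subseteq> W"
  by (auto simp: span_in_def)

lemma span_base: "X \<subseteq> span_in E Q V X"
  by (auto simp: span_in_def)

text \<open>
  This replaces induction on the length of a linear combination. The vectors all of whose
  multiples can be added without leaving \<open>R\<close> form an internal subspace that contains the basis.
\<close>

lemma vector_induct [consumes 1, case_names definable zero step]: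
  assumes "v \<in> carrier V" "definable (\<lambda>s. R (s 0))" "R \<zero>\<^bsub>V\<^esub>"
    and step: "\<And>v b q. v \<in> carrier V \<Longrightarrow> R v \<Longrightarrow> b \<in> B \<Longrightarrow> q \<in> carrier Q \<Longrightarrow> R (v \<oplus>\<^bsub>V\<^esub> q \<odot>\<^bsub>V\<^esub> b)"
  shows "R v"
proof -
  define Y where "Y = {y \<in> carrier V. \<forall>q\<in>carrier Q. \<forall>x\<in>carrier V. R x \<longrightarrow> R (addV x (smultV q y))}"
  have Y: "y \<in> Y \<longleftrightarrow> y \<in> carrier V \<and>
      (\<forall>q\<in>carrier Q. \<forall>x\<in>carrier V. R x \<longrightarrow> R (x \<oplus>\<^bsub>V\<^esub> q \<odot>\<^bsub>V\<^esub> y))" for y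
    by (auto simp: Y_def)
  have "internal Y"
    unfolding Y_def by (intro internal_separation definable_intros definable_subst1[of R, OF assms(2)])
  moreover have "submodule Y Q V"
    unfolding submodule_iff
  proof (intro conjI ballI)
    show "Y \<subseteq> carrier V" "\<zero>\<^bsub>V\<^esub> \<in> Y" by (auto simp: Y)
    fix y y' assume y: "y \<in> Y" "y' \<in> Y"
    have "R (x \<oplus>\<^bsub>V\<^esub> q \<odot>\<^bsub>V\<^esub> (y \<oplus>\<^bsub>V\<^esub> y'))" if "q \<in> carrier Q" "x \<in> carrier V" "R x" for q x
    proof -
      have "R ((x \<oplus>\<^bsub>V\<^esub> q \<odot>\<^bsub>V\<^esub> y) \<oplus>\<^bsub>V\<^esub> q \<odot>\<^bsub>V\<^esub> y')" using y that by (simp add: Y)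
      then show ?thesis using y that by (simp add: Y smult_r_distr M.a_assoc)
    qed
    then show "addV y y' \<in> Y" using y by (simp add: Y)
  next
    fix p y assume y: "p \<in> carrier Q" "y \<in> Y"
    have "R (x \<oplus>\<^bsub>V\<^esub> q \<odot>\<^bsub>V\<^esub> (p \<odot>\<^bsub>V\<^esub> y))" if "q \<in> carrier Q" "x \<in> carrier V" "R x" for q x
    proof -
      have "R (x \<oplus>\<^bsub>V\<^esub> (q \<otimes> p) \<odot>\<^bsub>V\<^esub> y)" using y that by (simp add: Y)
      then show ?thesis using y that by (simp add: Y smult_assoc1)
    qed
    then show "smultV p y \<in> Y" using y by (simp add: Y)
  qed
  moreover have "B \<subseteq> Y" using step by (auto simp: Y)
  ultimately have "carrier V \<subseteq> Y" using span_minimal B_spanning by blast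
  then have "R (\<zero>\<^bsub>V\<^esub> \<oplus>\<^bsub>V\<^esub> \<one> \<odot>\<^bsub>V\<^esub> v)" using assms(1,3) Y[of v] by blast
  then show ?thesis using assms(1) by simp
qed

text \<open>
  The vectors whose coordinate at \<open>b\<close> is zero. The scalar \<open>q\<close> with \<open>v + q b\<close> in this hyperplane, which exists and
  is unique, is the negative of the coordinate of \<open>v\<close> at \<open>b\<close>. It stands for the coordinate below,
  because its defining condition involves only addition and scalar multiplication of vectors.
\<close>

definition hyperplane :: "'m \<Rightarrow> 'm set" where
  "hyperplane b = span_in E Q V (B - {b})"

lemma submodule_hyperplane: "submodule (hyperplane b) Q V"
  unfolding hyperplane_def using B_subset by (intro submodule_span) auto

lemma hyperplane_closed [simp, intro]: "v \<in> hyperplane b \<Longrightarrow> v \<in> carrier V"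
  using submodule_hyperplane[of b] unfolding submodule_iff by blast

lemma hyperplane_zero [simp]: "\<zero>\<^bsub>V\<^esub> \<in> hyperplane b"
  using submodule_hyperplane[of b] unfolding submodule_iff by blast

lemma hyperplane_add [intro]: "v \<in> hyperplane b \<Longrightarrow> w \<in> hyperplane b \<Longrightarrow> v \<oplus>\<^bsub>V\<^esub> w \<in> hyperplane b"
  using submoduleE(5)[OF submodule_hyperplane] .

lemma hyperplane_smult [intro]: "q \<in> carrier Q \<Longrightarrow> v \<in> hyperplane b \<Longrightarrow> q \<odot>\<^bsub>V\<^esub> v \<in> hyperplane b"
  using submoduleE(4)[OF submodule_hyperplane] .

lemma hyperplane_minus [intro]: "v \<in> hyperplane b \<Longrightarrow> \<ominus>\<^bsub>V\<^esub> v \<in> hyperplane b"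
  using submoduleE(3)[OF submodule_hyperplane] .

lemma hyperplane_cancel:
  assumes "v \<oplus>\<^bsub>V\<^esub> w \<in> hyperplane b" "w \<in> hyperplane b" "v \<in> carrier V"
  shows "v \<in> hyperplane b"
proof -
  have "(v \<oplus>\<^bsub>V\<^esub> w) \<oplus>\<^bsub>V\<^esub> \<ominus>\<^bsub>V\<^esub> w \<in> hyperplane b" using assms by blast
  then show ?thesis using assms by (simp add: M.a_assoc M.r_neg)
qed

lemma hyperplane_base: "b' \<in> B \<Longrightarrow> b' \<noteq> b \<Longrightarrow> b' \<in> hyperplane b"
  using span_base[of "B - {b}"] unfolding hyperplane_def by blast

lemma hyperplane_scalar_zero:
  assumes "b \<in> B" "v \<in> hyperplane b" "q \<in> carrier Q" "v \<oplus>\<^bsub>V\<^esub> q \<odot>\<^bsub>V\<^esub> b \<in> hyperplane b"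
  shows "q = \<zero>"
proof (rule ccontr)
  assume "q \<noteq> \<zero>"
  then have inv: "inv q \<in> carrier Q" "inv q \<otimes> q = \<one>" using assms field_Units by auto
  have "q \<odot>\<^bsub>V\<^esub> b \<in> hyperplane b"
    using hyperplane_cancel[of "q \<odot>\<^bsub>V\<^esub> b" v] assms by (simp add: M.a_comm)
  then have "inv q \<odot>\<^bsub>V\<^esub> (q \<odot>\<^bsub>V\<^esub> b) \<in> hyperplane b" using inv by blast
  then have "b \<in> hyperplane b" using inv assms by (simp flip: smult_assoc1)
  then show False using B_independent assms by (simp add: hyperplane_def)
qed

text \<open>
  A condition from which the definability of the hyperplane can be read off, uniformly in \<open>b\<close>. The
  definition of \<open>N\<close> quantifies over \<open>b\<close>.
\<close>

lemma mem_hyperplane_iff: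
  "v \<in> hyperplane b \<longleftrightarrow> (\<forall>w. (\<forall>x. E x w \<longrightarrow> x \<in> carrier V) \<and> E \<zero>\<^bsub>V\<^esub> w \<and>
      (\<forall>x. E x w \<longrightarrow> (\<forall>y. E y w \<longrightarrow> E (addV x y) w)) \<and>
      (\<forall>q\<in>carrier Q. \<forall>x. E x w \<longrightarrow> E (smultV q x) w) \<and>
      (\<forall>x\<in>B. x \<noteq> b \<longrightarrow> E x w) \<longrightarrow> E v w)"
proof -
  have "v \<in> hyperplane b \<longleftrightarrow> (\<forall>w. submodule {x. E x w} Q V \<and> B - {b} \<subseteq> {x. E x w} \<longrightarrow> v \<in> {x. E x w})"
    unfolding hyperplane_def span_in_def internal_set_def by blast
  also have "\<dots> \<longleftrightarrow> (\<forall>w. (\<forall>x. E x w \<longrightarrow> x \<in> carrier V) \<and> E \<zero>\<^bsub>V\<^esub> w \<and>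
      (\<forall>x. E x w \<longrightarrow> (\<forall>y. E y w \<longrightarrow> E (addV x y) w)) \<and>
      (\<forall>q\<in>carrier Q. \<forall>x. E x w \<longrightarrow> E (smultV q x) w) \<and>
      (\<forall>x\<in>B. x \<noteq> b \<longrightarrow> E x w) \<longrightarrow> E v w)"
    unfolding submodule_iff subset_iff mem_Collect_eq Ball_def Diff_iff singleton_iff by (simp only: conj_assoc simp_thms imp_conjL)
  finally show ?thesis .
qed

lemma definable_hyperplane [definable_intros]:
  "definable_fun f \<Longrightarrow> definable_fun g \<Longrightarrow> definable (\<lambda>s. f s \<in> hyperplane (g s))"
  by (rule definable_subst2) (unfold mem_hyperplane_iff, intro definable_intros)

lemma coordinate_exists:
  assumes "b \<in> B" "v \<in> carrier V"
  obtains q where "q \<in> carrier Q" "v \<oplus>\<^bsub>V\<^esub> q \<odot>\<^bsub>V\<^esub> b \<in> hyperplane b"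
proof -
  have "\<exists>q\<in>carrier Q. addV v (smultV q b) \<in> hyperplane b" using assms(2)
  proof (induction rule: vector_induct)
    case definable show ?case by (intro definable_intros)
  next
    case zero show ?case using assms(1) by (intro bexI[of _ \<zero>]) auto
  next
    case (step v b' p)
    then obtain q where q: "q \<in> carrier Q" "v \<oplus>\<^bsub>V\<^esub> q \<odot>\<^bsub>V\<^esub> b \<in> hyperplane b" using assms(1) by auto
    show ?case
    proof (cases "b' = b")
      case True
      have "(v \<oplus>\<^bsub>V\<^esub> p \<odot>\<^bsub>V\<^esub> b) \<oplus>\<^bsub>V\<^esub> (\<ominus> p \<oplus> q) \<odot>\<^bsub>V\<^esub> b = v \<oplus>\<^bsub>V\<^esub> q \<odot>\<^bsub>V\<^esub> b"
        using step q assms(1) by (simp add: smult_l_distr smult_l_minus M.a_assoc M.r_neg1 M.r_neg2)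
      then show ?thesis using True step q assms(1) by (intro bexI[of _ "\<ominus> p \<oplus> q"]) auto
    next
      case False
      have "(v \<oplus>\<^bsub>V\<^esub> p \<odot>\<^bsub>V\<^esub> b') \<oplus>\<^bsub>V\<^esub> q \<odot>\<^bsub>V\<^esub> b = (v \<oplus>\<^bsub>V\<^esub> q \<odot>\<^bsub>V\<^esub> b) \<oplus>\<^bsub>V\<^esub> p \<odot>\<^bsub>V\<^esub> b'"
        using step q assms(1) by (simp add: M.a_ac)
      also have "\<dots> \<in> hyperplane b" using q step False hyperplane_base by blast
      finally show ?thesis using step q assms(1) by auto
    qed
  qed
  with assms that show thesis by auto
qed

section \<open>The sum of the squares of the coordinates\<close>

definition closed_under_squares :: "'m \<Rightarrow> bool" where
  "closed_under_squares g \<longleftrightarrow> E (opair E \<zero>\<^bsub>V\<^esub> \<zero>) g \<and>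
    (\<forall>v\<in>carrier V. \<forall>r\<in>carrier Q. \<forall>b\<in>B. \<forall>q\<in>carrier Q. E (opair E v r) g \<longrightarrow> v \<in> hyperplane b \<longrightarrow>
      E (opair E (addV v (smultV q b)) (addQ r (multQ q q))) g)"

text \<open>
  Since \<open>v\<close> has coordinate zero at \<open>b\<close>, the step from \<open>v\<close> to \<open>v + q b\<close> gives it the coordinate \<open>q\<close> there. In the
  least relation closed under such steps, \<open>v\<close> is therefore related to the sum of the squares of its coordinates.
\<close>

definition square_sum :: "'m \<Rightarrow> 'm \<Rightarrow> bool" where
  "square_sum v r \<longleftrightarrow> v \<in> carrier V \<and> r \<in> carrier Q \<and>
    (\<forall>g. closed_under_squares g \<longrightarrow> E (opair E v r) g)"

lemma definable_square_sum [definable_intros]: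
  "definable_fun f \<Longrightarrow> definable_fun g \<Longrightarrow> definable (\<lambda>s. square_sum (f s) (g s))"
  by (rule definable_subst2) (unfold square_sum_def closed_under_squares_def, intro definable_intros)

lemma square_sum_closed: "square_sum v r \<Longrightarrow> v \<in> carrier V" "square_sum v r \<Longrightarrow> r \<in> carrier Q"
  by (auto simp: square_sum_def)

lemma square_sum_zero: "square_sum \<zero>\<^bsub>V\<^esub> \<zero>"
  by (auto simp: square_sum_def closed_under_squares_def)

lemma square_sum_step:
  assumes "square_sum v r" "b \<in> B" "v \<in> hyperplane b" "q \<in> carrier Q"
  shows "square_sum (v \<oplus>\<^bsub>V\<^esub> q \<odot>\<^bsub>V\<^esub> b) (r \<oplus> q \<otimes> q)"
  unfolding square_sum_def
proof (intro conjI allI impI)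
  fix g assume g: "closed_under_squares g"
  then have "E (opair E v r) g" using assms by (simp add: square_sum_def)
  then have "E (opair E (addV v (smultV q b)) (addQ r (multQ q q))) g"
    using g assms square_sum_closed[OF assms(1)] by (simp add: closed_under_squares_def)
  then show "E (opair E (v \<oplus>\<^bsub>V\<^esub> q \<odot>\<^bsub>V\<^esub> b) (r \<oplus> q \<otimes> q)) g"
    using assms square_sum_closed[OF assms(1)] by simp
qed (use assms square_sum_closed[OF assms(1)] in auto)

lemma square_sum_induct [consumes 1, case_names definable zero step]:
  assumes "square_sum v r" "definable (\<lambda>s. R (s 0) (s 1))" "R \<zero>\<^bsub>V\<^esub> \<zero>"
    and step: "\<And>v r b q. square_sum v r \<Longrightarrow> R v r \<Longrightarrow> b \<in> B \<Longrightarrow> v \<in> hyperplane b \<Longrightarrow> q \<in> carrier Q \<Longrightarrow>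
      R (v \<oplus>\<^bsub>V\<^esub> q \<odot>\<^bsub>V\<^esub> b) (r \<oplus> q \<otimes> q)"
  shows "R v r"
proof -
  have "internal {opair E v r | v r. v \<in> carrier V \<and> r \<in> carrier Q \<and> (square_sum v r \<and> R v r)}"
    by (intro internal_relation definable_intros assms(2))
  then obtain g where "{opair E v r | v r. v \<in> carrier V \<and> r \<in> carrier Q \<and> (square_sum v r \<and> R v r)} = {x. E x g}"
    by (auto simp: internal_set_def)
  then have "E (opair E v r) g \<longleftrightarrow> opair E v r \<in> {opair E v r | v r. v \<in> carrier V \<and> r \<in> carrier Q \<and> (square_sum v r \<and> R v r)}" for v r
    by simp
  then have g: "E (opair E v r) g \<longleftrightarrow> square_sum v r \<and> R v r" for v r
    using square_sum_closed by auto
  have "closed_under_squares g"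
    unfolding closed_under_squares_def g
    using square_sum_zero square_sum_step assms(3) step by simp
  with assms(1) have "E (opair E v r) g" by (simp only: square_sum_def)
  with g show ?thesis by blast
qed

text \<open>
  Deleting the coordinate at \<open>b\<close>, which is \<open>-q\<close>, subtracts its square. If the last step of the
  construction of \<open>v\<close> was at \<open>b\<close>, it is undone. If it was at another basis vector, then \<open>b\<close> is
  deleted from the previous vector first, and the step is repeated.
\<close>

lemma square_sum_remove:
  assumes "square_sum v r" "b \<in> B" "q \<in> carrier Q" "v \<oplus>\<^bsub>V\<^esub> q \<odot>\<^bsub>V\<^esub> b \<in> hyperplane b"
  shows "\<exists>r'. r = r' \<oplus> q \<otimes> q \<and> square_sum (v \<oplus>\<^bsub>V\<^esub> q \<odot>\<^bsub>V\<^esub> b) r'"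
proof -
  have "\<forall>q\<in>carrier Q. addV v (smultV q b) \<in> hyperplane b \<longrightarrow>
    (\<exists>r'. r = addQ r' (multQ q q) \<and> square_sum (addV v (smultV q b)) r')" using assms(1)
  proof (induction rule: square_sum_induct)
    case definable show ?case by (intro definable_intros)
  next
    case zero
    show ?case
    proof (intro ballI impI)
      fix q assume q: "q \<in> carrier Q" "addV \<zero>\<^bsub>V\<^esub> (smultV q b) \<in> hyperplane b"
      then have "q = \<zero>"
        using hyperplane_scalar_zero[OF assms(2) hyperplane_zero q(1)] assms(2) by simp
      then show "\<exists>r'. \<zero> = addQ r' (multQ q q) \<and> square_sum (addV \<zero>\<^bsub>V\<^esub> (smultV q b)) r'"
        using square_sum_zero assms(2) by (intro exI[of _ \<zero>]) simp
    qed
  next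
    case (step v r b' p)
    note [simp] = square_sum_closed[OF step.hyps(1)] step.hyps(2,4) assms(2)
    show ?case
    proof (intro ballI impI)
      fix q assume q [simp]: "q \<in> carrier Q"
        and "addV (v \<oplus>\<^bsub>V\<^esub> p \<odot>\<^bsub>V\<^esub> b') (smultV q b) \<in> hyperplane b"
      then have h: "(v \<oplus>\<^bsub>V\<^esub> p \<odot>\<^bsub>V\<^esub> b') \<oplus>\<^bsub>V\<^esub> q \<odot>\<^bsub>V\<^esub> b \<in> hyperplane b" by simp
      have "\<exists>r'\<in>carrier Q. r \<oplus> p \<otimes> p = r' \<oplus> q \<otimes> q \<and> square_sum ((v \<oplus>\<^bsub>V\<^esub> p \<odot>\<^bsub>V\<^esub> b') \<oplus>\<^bsub>V\<^esub> q \<odot>\<^bsub>V\<^esub> b) r'"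
      proof (cases "b' = b")
        case True
        have "v \<oplus>\<^bsub>V\<^esub> (p \<oplus> q) \<odot>\<^bsub>V\<^esub> b \<in> hyperplane b"
          using h True by (simp add: smult_l_distr M.a_assoc)
        with step.hyps(3) True have "p \<oplus> q = \<zero>" by (intro hyperplane_scalar_zero[of b v]) auto
        then have qp: "q = \<ominus> p" using sum_zero_eq_neg[of q p] by (simp add: R.a_comm)
        have "(v \<oplus>\<^bsub>V\<^esub> p \<odot>\<^bsub>V\<^esub> b) \<oplus>\<^bsub>V\<^esub> q \<odot>\<^bsub>V\<^esub> b = v"
          by (simp add: qp smult_l_minus M.a_assoc M.r_neg)
        moreover have "q \<otimes> q = p \<otimes> p" by (simp add: qp l_minus r_minus)
        ultimately show ?thesis using step.hyps(1) True by (intro bexI[of _ r]) auto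
      next
        case False
        have eq: "(v \<oplus>\<^bsub>V\<^esub> p \<odot>\<^bsub>V\<^esub> b') \<oplus>\<^bsub>V\<^esub> q \<odot>\<^bsub>V\<^esub> b = (v \<oplus>\<^bsub>V\<^esub> q \<odot>\<^bsub>V\<^esub> b) \<oplus>\<^bsub>V\<^esub> p \<odot>\<^bsub>V\<^esub> b'"
          by (simp add: M.a_ac)
        have "v \<oplus>\<^bsub>V\<^esub> q \<odot>\<^bsub>V\<^esub> b \<in> hyperplane b"
          using hyperplane_cancel[of "v \<oplus>\<^bsub>V\<^esub> q \<odot>\<^bsub>V\<^esub> b" "p \<odot>\<^bsub>V\<^esub> b'"] h eq
            hyperplane_smult[OF step.hyps(4) hyperplane_base[OF step.hyps(2) False]] by simp
        then obtain r' where r': "r = addQ r' (q \<otimes> q)" "square_sum (v \<oplus>\<^bsub>V\<^esub> q \<odot>\<^bsub>V\<^esub> b) r'"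
          using step.IH q by auto
        note [simp] = square_sum_closed(2)[OF r'(2)]
        have "v \<oplus>\<^bsub>V\<^esub> q \<odot>\<^bsub>V\<^esub> b \<in> hyperplane b'"
          using False by (intro hyperplane_add hyperplane_smult hyperplane_base assms(2) q step.hyps(3)) simp
        then have "square_sum ((v \<oplus>\<^bsub>V\<^esub> q \<odot>\<^bsub>V\<^esub> b) \<oplus>\<^bsub>V\<^esub> p \<odot>\<^bsub>V\<^esub> b') (r' \<oplus> p \<otimes> p)"
          using square_sum_step r'(2) by simp
        moreover have "r \<oplus> p \<otimes> p = (r' \<oplus> p \<otimes> p) \<oplus> q \<otimes> q" using r'(1) by (simp add: R.a_ac)
        ultimately show ?thesis unfolding eq by (intro bexI[of _ "r' \<oplus> p \<otimes> p"]) auto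
      qed
      then obtain r' where "r' \<in> carrier Q" "r \<oplus> p \<otimes> p = r' \<oplus> q \<otimes> q"
        "square_sum ((v \<oplus>\<^bsub>V\<^esub> p \<odot>\<^bsub>V\<^esub> b') \<oplus>\<^bsub>V\<^esub> q \<odot>\<^bsub>V\<^esub> b) r'" by blast
      then show "\<exists>r'. r \<oplus> p \<otimes> p = addQ r' (multQ q q) \<and>
          square_sum (addV (v \<oplus>\<^bsub>V\<^esub> p \<odot>\<^bsub>V\<^esub> b') (smultV q b)) r'"
        by (intro exI[of _ r']) simp
    qed
  qed
  moreover have "addV v (smultV q b) = v \<oplus>\<^bsub>V\<^esub> q \<odot>\<^bsub>V\<^esub> b"
    using assms(2,3) square_sum_closed[OF assms(1)] by simp
  ultimately obtain r' where r': "r = addQ r' (multQ q q)" "square_sum (v \<oplus>\<^bsub>V\<^esub> q \<odot>\<^bsub>V\<^esub> b) r'"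
    using assms(3,4) by auto
  then show ?thesis using assms(3) square_sum_closed(2)[OF r'(2)] by auto
qed

text \<open>
  A step that leads to the vector zero is trivial, since a basis vector does not lie in the span of the
  others.
\<close>

lemma square_sum_of_zero:
  assumes "square_sum \<zero>\<^bsub>V\<^esub> r" shows "r = \<zero>"
proof -
  have "v = \<zero>\<^bsub>V\<^esub> \<longrightarrow> r = \<zero>" if "square_sum v r" for v using that
  proof (induction rule: square_sum_induct)
    case definable show ?case by (intro definable_intros)
  next
    case zero show ?case by simp
  next
    case (step v r b q)
    show ?case
    proof
      assume *: "v \<oplus>\<^bsub>V\<^esub> q \<odot>\<^bsub>V\<^esub> b = \<zero>\<^bsub>V\<^esub>"
      then have "q = \<zero>" using hyperplane_scalar_zero[of b v q] step by simp
      with * step show "r \<oplus> q \<otimes> q = \<zero>" by simp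
    qed
  qed
  with assms show ?thesis by blast
qed

text \<open>
  The last step of the construction of \<open>v\<close> can be undone in any pair \<open>(v, r')\<close> by
  \<open>square_sum_remove\<close>, which reduces the claim to the vector before that step.
\<close>

lemma square_sum_functional:
  assumes "square_sum v r" "square_sum v r'" shows "r' = r"
proof -
  have "\<forall>r'. square_sum v r' \<longrightarrow> r' = r" using assms(1)
  proof (induction rule: square_sum_induct)
    case definable show ?case by (intro definable_intros)
  next
    case zero show ?case using square_sum_of_zero by simp
  next
    case (step v r b q)
    show ?case
    proof (intro allI impI)
      fix r' assume r': "square_sum (v \<oplus>\<^bsub>V\<^esub> q \<odot>\<^bsub>V\<^esub> b) r'"
      have eq: "(v \<oplus>\<^bsub>V\<^esub> q \<odot>\<^bsub>V\<^esub> b) \<oplus>\<^bsub>V\<^esub> (\<ominus> q) \<odot>\<^bsub>V\<^esub> b = v"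
        using step.hyps(2,4) square_sum_closed[OF step.hyps(1)] by (simp add: smult_l_minus M.a_assoc M.r_neg)
      obtain r'' where r'': "r' = r'' \<oplus> \<ominus> q \<otimes> \<ominus> q" "square_sum v r''"
        using square_sum_remove[OF r' step.hyps(2), of "\<ominus> q", unfolded eq] step.hyps(3,4) by auto
      moreover have "r'' = r" using step.IH r''(2) by blast
      moreover have "\<ominus> q \<otimes> \<ominus> q = q \<otimes> q" using step.hyps(4) by (simp add: l_minus r_minus)
      ultimately show "r' = r \<oplus> q \<otimes> q" by simp
    qed
  qed
  with assms show ?thesis by blast
qed

text \<open>
  With \<open>-p\<close> the coordinate of \<open>v\<close> at \<open>b\<close>, adding \<open>q b\<close> changes the sum of squares by
  \<open>(q - p)\<^sup>2 - p\<^sup>2 = q\<^sup>2 - 2 q p\<close>: the coordinate is deleted and \<open>q - p\<close> is put in its place.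
\<close>

lemma square_sum_update:
  assumes "square_sum v r" "b \<in> B" "p \<in> carrier Q" "q \<in> carrier Q" "v \<oplus>\<^bsub>V\<^esub> p \<odot>\<^bsub>V\<^esub> b \<in> hyperplane b"
  shows "square_sum (v \<oplus>\<^bsub>V\<^esub> q \<odot>\<^bsub>V\<^esub> b) (r \<oplus> (q \<otimes> q \<ominus> (q \<otimes> p \<oplus> q \<otimes> p)))"
proof -
  obtain r' where r': "r = r' \<oplus> p \<otimes> p" "square_sum (v \<oplus>\<^bsub>V\<^esub> p \<odot>\<^bsub>V\<^esub> b) r'"
    using square_sum_remove[OF assms(1,2,3,5)] by blast
  note [simp] = square_sum_closed(1)[OF assms(1)] square_sum_closed(2)[OF r'(2)] assms(2-4)
  have "square_sum ((v \<oplus>\<^bsub>V\<^esub> p \<odot>\<^bsub>V\<^esub> b) \<oplus>\<^bsub>V\<^esub> (\<ominus> p \<oplus> q) \<odot>\<^bsub>V\<^esub> b) (r' \<oplus> (\<ominus> p \<oplus> q) \<otimes> (\<ominus> p \<oplus> q))"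
    using assms r' by (intro square_sum_step) auto
  moreover have "(v \<oplus>\<^bsub>V\<^esub> p \<odot>\<^bsub>V\<^esub> b) \<oplus>\<^bsub>V\<^esub> (\<ominus> p \<oplus> q) \<odot>\<^bsub>V\<^esub> b = v \<oplus>\<^bsub>V\<^esub> q \<odot>\<^bsub>V\<^esub> b"
    by (simp add: smult_l_distr smult_l_minus M.a_assoc M.r_neg1 M.r_neg2)
  moreover have "r' \<oplus> (\<ominus> p \<oplus> q) \<otimes> (\<ominus> p \<oplus> q) = (r' \<oplus> p \<otimes> p) \<oplus> (q \<otimes> q \<ominus> (q \<otimes> p \<oplus> q \<otimes> p))"
    using square_sum_closed(2)[OF r'(2)] assms(3,4) by algebra
  ultimately show ?thesis using r' by simp
qed

lemma square_sum_total: assumes "v \<in> carrier V" shows "\<exists>r. square_sum v r"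
  using assms
proof (induction rule: vector_induct)
  case definable show ?case by (intro definable_intros)
next
  case zero show ?case using square_sum_zero by blast
next
  case (step v b q)
  obtain p where "p \<in> carrier Q" "v \<oplus>\<^bsub>V\<^esub> p \<odot>\<^bsub>V\<^esub> b \<in> hyperplane b"
    using coordinate_exists[OF step.hyps(2,1)] .
  with step show ?case using square_sum_update by blast
qed

definition norm2 :: "'m \<Rightarrow> 'm" where
  "norm2 v = (if v \<in> carrier V then THE r. square_sum v r else \<zero>)"

lemma norm2_eq_iff: "v \<in> carrier V \<Longrightarrow> r = norm2 v \<longleftrightarrow> square_sum v r"
  using square_sum_total square_sum_functional by (metis norm2_def the_equality)

lemma definable_fun_norm2 [definable_intros]: assumes "definable_fun f" shows "definable_fun (\<lambda>s. norm2 (f s))"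
proof (rule definable_fun_subst1[OF _ assms])
  have "r = norm2 v \<longleftrightarrow> v \<in> carrier V \<and> square_sum v r \<or> v \<notin> carrier V \<and> r = \<zero>" for r v
    using norm2_eq_iff by (auto simp: norm2_def)
  then show "definable (\<lambda>s. s 0 = norm2 (s 1))" by (simp only:) (intro definable_intros)
qed

lemma square_sum_norm2: "v \<in> carrier V \<Longrightarrow> square_sum v (norm2 v)"
  using norm2_eq_iff by blast

lemma norm2_closed [simp, intro]: "v \<in> carrier V \<Longrightarrow> norm2 v \<in> carrier Q"
  using square_sum_norm2 square_sum_closed by blast

lemma norm2_zero [simp]: "norm2 \<zero>\<^bsub>V\<^esub> = \<zero>"
  using norm2_eq_iff[of "\<zero>\<^bsub>V\<^esub>" \<zero>] square_sum_zero by simp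

lemma norm2_update:
  assumes "v \<in> carrier V" "b \<in> B" "p \<in> carrier Q" "q \<in> carrier Q" "v \<oplus>\<^bsub>V\<^esub> p \<odot>\<^bsub>V\<^esub> b \<in> hyperplane b"
  shows "norm2 (v \<oplus>\<^bsub>V\<^esub> q \<odot>\<^bsub>V\<^esub> b) = norm2 v \<oplus> (q \<otimes> q \<ominus> (q \<otimes> p \<oplus> q \<otimes> p))"
proof -
  have "square_sum (v \<oplus>\<^bsub>V\<^esub> q \<odot>\<^bsub>V\<^esub> b) (norm2 v \<oplus> (q \<otimes> q \<ominus> (q \<otimes> p \<oplus> q \<otimes> p)))"
    using square_sum_update[OF square_sum_norm2] assms by blast
  then show ?thesis using norm2_eq_iff square_sum_closed by metis
qed

text \<open>
  The steps of the construction only add squares, which are nonnegative, and a sum of nonnegative numbers vanishes only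
  if both of them do.
\<close>

lemma norm2_definite:
  assumes "v \<in> carrier V" shows "norm2 v \<in> nonneg" "norm2 v = \<zero> \<Longrightarrow> v = \<zero>\<^bsub>V\<^esub>"
proof -
  have "norm2 v \<in> nonneg \<and> (norm2 v = \<zero> \<longrightarrow> v = \<zero>\<^bsub>V\<^esub>)" using square_sum_norm2[OF assms]
  proof (induction rule: square_sum_induct)
    case definable show ?case by (intro definable_intros)
  next
    case zero show ?case using nonneg_zero by simp
  next
    case (step v r b q)
    have "v \<oplus>\<^bsub>V\<^esub> q \<odot>\<^bsub>V\<^esub> b = \<zero>\<^bsub>V\<^esub>" if "r \<oplus> q \<otimes> q = \<zero>"
    proof -
      have "r = \<zero>" "q \<otimes> q = \<zero>"
        using nonneg_add_eq_zero[OF _ square_nonneg that] step by auto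
      then show ?thesis using step integral[of q q] by auto
    qed
    then show ?case using step nonneg_add square_nonneg by blast
  qed
  then show "norm2 v \<in> nonneg" "norm2 v = \<zero> \<Longrightarrow> v = \<zero>\<^bsub>V\<^esub>" by auto
qed

lemma hyperplane_coordinate_add:
  assumes "v \<in> carrier V" "w \<in> carrier V" "b \<in> B" "p \<in> carrier Q" "q \<in> carrier Q"
    "v \<oplus>\<^bsub>V\<^esub> p \<odot>\<^bsub>V\<^esub> b \<in> hyperplane b" "w \<oplus>\<^bsub>V\<^esub> q \<odot>\<^bsub>V\<^esub> b \<in> hyperplane b"
  shows "(v \<oplus>\<^bsub>V\<^esub> w) \<oplus>\<^bsub>V\<^esub> (p \<oplus> q) \<odot>\<^bsub>V\<^esub> b \<in> hyperplane b"
proof -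
  have "(v \<oplus>\<^bsub>V\<^esub> w) \<oplus>\<^bsub>V\<^esub> (p \<oplus> q) \<odot>\<^bsub>V\<^esub> b = (v \<oplus>\<^bsub>V\<^esub> p \<odot>\<^bsub>V\<^esub> b) \<oplus>\<^bsub>V\<^esub> (w \<oplus>\<^bsub>V\<^esub> q \<odot>\<^bsub>V\<^esub> b)"
    using assms(1-5) by (simp add: smult_l_distr M.a_ac)
  then show ?thesis using assms by auto
qed

text \<open>
  When \<open>q b\<close> is added to \<open>w\<close>, each side changes at two terms. The change of \<open>N\<close> at a vector is \<open>q\<^sup>2\<close> plus a
  term linear in its coordinate at \<open>b\<close>, and the coordinates of \<open>u + v + w\<close> and \<open>w\<close> have the same sum as
  those of \<open>u + w\<close> and \<open>v + w\<close>.
\<close>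

lemma norm2_quadratic:
  assumes "u \<in> carrier V" "v \<in> carrier V" "w \<in> carrier V"
  shows "norm2 (u \<oplus>\<^bsub>V\<^esub> v \<oplus>\<^bsub>V\<^esub> w) \<oplus> (norm2 u \<oplus> norm2 v \<oplus> norm2 w)
    = norm2 (u \<oplus>\<^bsub>V\<^esub> v) \<oplus> norm2 (u \<oplus>\<^bsub>V\<^esub> w) \<oplus> norm2 (v \<oplus>\<^bsub>V\<^esub> w)"
proof -
  note [simp] = assms(1,2)
  have "addQ (norm2 (addV (addV u v) w)) (addQ (addQ (norm2 u) (norm2 v)) (norm2 w))
    = addQ (addQ (norm2 (addV u v)) (norm2 (addV u w))) (norm2 (addV v w))" using assms(3)
  proof (induction rule: vector_induct)
    case definable show ?case by (intro definable_intros)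
  next
    case zero show ?case by (simp add: R.a_ac)
  next
    case (step w b q)
    note [simp] = step.hyps
    obtain p1 where p1 [simp]: "p1 \<in> carrier Q" and h1: "u \<oplus>\<^bsub>V\<^esub> p1 \<odot>\<^bsub>V\<^esub> b \<in> hyperplane b"
      using coordinate_exists[OF step.hyps(2) assms(1)] .
    obtain p2 where p2 [simp]: "p2 \<in> carrier Q" and h2: "v \<oplus>\<^bsub>V\<^esub> p2 \<odot>\<^bsub>V\<^esub> b \<in> hyperplane b"
      using coordinate_exists[OF step.hyps(2) assms(2)] .
    obtain p3 where p3 [simp]: "p3 \<in> carrier Q" and h3: "w \<oplus>\<^bsub>V\<^esub> p3 \<odot>\<^bsub>V\<^esub> b \<in> hyperplane b"
      using coordinate_exists[OF step.hyps(2,1)] .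
    define D where "D p = q \<otimes> q \<ominus> (q \<otimes> p \<oplus> q \<otimes> p)" for p
    have D [simp]: "p \<in> carrier Q \<Longrightarrow> D p \<in> carrier Q" for p by (simp add: D_def)
    have update: "norm2 (x \<oplus>\<^bsub>V\<^esub> q \<odot>\<^bsub>V\<^esub> b) = norm2 x \<oplus> D p"
      if "x \<in> carrier V" "p \<in> carrier Q" "x \<oplus>\<^bsub>V\<^esub> p \<odot>\<^bsub>V\<^esub> b \<in> hyperplane b" for x p
      using norm2_update[OF that(1) step.hyps(2) that(2) step.hyps(3) that(3)] by (simp add: D_def)
    have 12: "(u \<oplus>\<^bsub>V\<^esub> v) \<oplus>\<^bsub>V\<^esub> (p1 \<oplus> p2) \<odot>\<^bsub>V\<^esub> b \<in> hyperplane b"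
      and 13: "(u \<oplus>\<^bsub>V\<^esub> w) \<oplus>\<^bsub>V\<^esub> (p1 \<oplus> p3) \<odot>\<^bsub>V\<^esub> b \<in> hyperplane b"
      and 23: "(v \<oplus>\<^bsub>V\<^esub> w) \<oplus>\<^bsub>V\<^esub> (p2 \<oplus> p3) \<odot>\<^bsub>V\<^esub> b \<in> hyperplane b"
      by (intro hyperplane_coordinate_add h1 h2 h3; simp)+
    have 123: "((u \<oplus>\<^bsub>V\<^esub> v) \<oplus>\<^bsub>V\<^esub> w) \<oplus>\<^bsub>V\<^esub> ((p1 \<oplus> p2) \<oplus> p3) \<odot>\<^bsub>V\<^esub> b \<in> hyperplane b"
      by (intro hyperplane_coordinate_add 12 h3; simp)
    have "D ((p1 \<oplus> p2) \<oplus> p3) \<oplus> D p3 = D (p1 \<oplus> p3) \<oplus> D (p2 \<oplus> p3)"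
      unfolding D_def using p1 p2 p3 step.hyps(3) by algebra
    moreover have "norm2 (u \<oplus>\<^bsub>V\<^esub> v \<oplus>\<^bsub>V\<^esub> w) \<oplus> (norm2 u \<oplus> norm2 v \<oplus> norm2 w)
        = norm2 (u \<oplus>\<^bsub>V\<^esub> v) \<oplus> norm2 (u \<oplus>\<^bsub>V\<^esub> w) \<oplus> norm2 (v \<oplus>\<^bsub>V\<^esub> w)"
      using step.IH by simp
    ultimately have "(norm2 (u \<oplus>\<^bsub>V\<^esub> v \<oplus>\<^bsub>V\<^esub> w) \<oplus> (norm2 u \<oplus> norm2 v \<oplus> norm2 w)) \<oplus> (D ((p1 \<oplus> p2) \<oplus> p3) \<oplus> D p3)
        = (norm2 (u \<oplus>\<^bsub>V\<^esub> v) \<oplus> norm2 (u \<oplus>\<^bsub>V\<^esub> w) \<oplus> norm2 (v \<oplus>\<^bsub>V\<^esub> w)) \<oplus> (D (p1 \<oplus> p3) \<oplus> D (p2 \<oplus> p3))"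
      by simp
    then have "(norm2 (u \<oplus>\<^bsub>V\<^esub> v \<oplus>\<^bsub>V\<^esub> w) \<oplus> D ((p1 \<oplus> p2) \<oplus> p3)) \<oplus> (norm2 u \<oplus> norm2 v \<oplus> (norm2 w \<oplus> D p3))
        = norm2 (u \<oplus>\<^bsub>V\<^esub> v) \<oplus> (norm2 (u \<oplus>\<^bsub>V\<^esub> w) \<oplus> D (p1 \<oplus> p3)) \<oplus> (norm2 (v \<oplus>\<^bsub>V\<^esub> w) \<oplus> D (p2 \<oplus> p3))"
      by (simp add: R.a_ac)
    then have "norm2 ((u \<oplus>\<^bsub>V\<^esub> v \<oplus>\<^bsub>V\<^esub> w) \<oplus>\<^bsub>V\<^esub> q \<odot>\<^bsub>V\<^esub> b) \<oplus> (norm2 u \<oplus> norm2 v \<oplus> norm2 (w \<oplus>\<^bsub>V\<^esub> q \<odot>\<^bsub>V\<^esub> b))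
        = norm2 (u \<oplus>\<^bsub>V\<^esub> v) \<oplus> norm2 ((u \<oplus>\<^bsub>V\<^esub> w) \<oplus>\<^bsub>V\<^esub> q \<odot>\<^bsub>V\<^esub> b) \<oplus> norm2 ((v \<oplus>\<^bsub>V\<^esub> w) \<oplus>\<^bsub>V\<^esub> q \<odot>\<^bsub>V\<^esub> b)"
      using update[OF _ _ h3] update[OF _ _ 13] update[OF _ _ 23] update[OF _ _ 123] by simp
    then show ?case by (simp add: M.a_assoc)
  qed
  then show ?thesis using assms by simp
qed

section \<open>The colouring\<close>

lemma norm2_not_constant_on_FS:
  assumes "u \<in> carrier V" "v \<in> carrier V" "w \<in> carrier V" "u \<noteq> v" "u \<noteq> w" "v \<noteq> w"
    and const: "\<And>x y. x \<in> FS V {u, v, w} \<Longrightarrow> y \<in> FS V {u, v, w} \<Longrightarrow> norm2 x = norm2 y"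
  shows False
proof -
  have FS: "finsum V (\<lambda>a. a) F \<in> FS V {u, v, w}" if "F \<subseteq> {u, v, w}" "F \<noteq> {}" for F
    using that finite_subset[OF that(1)] by (auto simp: FS_def)
  have "u \<in> FS V {u, v, w}" "v \<in> FS V {u, v, w}" "w \<in> FS V {u, v, w}"
    using FS[of "{u}"] FS[of "{v}"] FS[of "{w}"] assms(1-3) by simp_all
  moreover have "u \<oplus>\<^bsub>V\<^esub> v \<in> FS V {u, v, w}" "u \<oplus>\<^bsub>V\<^esub> w \<in> FS V {u, v, w}" "v \<oplus>\<^bsub>V\<^esub> w \<in> FS V {u, v, w}"
    using FS[of "{u, v}"] FS[of "{u, w}"] FS[of "{v, w}"] assms(1-6) by simp_all
  moreover have "u \<oplus>\<^bsub>V\<^esub> v \<oplus>\<^bsub>V\<^esub> w \<in> FS V {u, v, w}"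
    using FS[of "{u, v, w}"] assms(1-6) by (simp add: M.a_assoc)
  ultimately have eq: "norm2 v = norm2 u" "norm2 w = norm2 u" "norm2 (u \<oplus>\<^bsub>V\<^esub> v) = norm2 u"
    "norm2 (u \<oplus>\<^bsub>V\<^esub> w) = norm2 u" "norm2 (v \<oplus>\<^bsub>V\<^esub> w) = norm2 u" "norm2 (u \<oplus>\<^bsub>V\<^esub> v \<oplus>\<^bsub>V\<^esub> w) = norm2 u"
    by (blast intro: const)+
  have "norm2 u = \<zero>" using norm2_quadratic[OF assms(1-3)] assms(1) unfolding eq by simp
  then have "u = \<zero>\<^bsub>V\<^esub>" "v = \<zero>\<^bsub>V\<^esub>" using norm2_definite(2) assms(1,2) eq by auto
  with assms(4) show False by simp
qed

definition colour :: "'m \<Rightarrow> 'm" where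
  "colour v = (THE n. n \<in> omega E \<and> least_code (norm2 v) (j n))"

lemma eq_colour_iff:
  assumes "v \<in> carrier V"
  shows "n = colour v \<longleftrightarrow> n \<in> omega E \<and> least_code (norm2 v) (j n)"
proof -
  obtain m where m: "least_code (norm2 v) m" "\<And>m'. least_code (norm2 v) m' \<Longrightarrow> m' = m"
    using ex1_least_code[OF norm2_definite(1)[OF assms]] by blast
  have "m \<in> naturals" using m(1) is_code_natural by (auto simp: least_code_def)
  then obtain n where "n \<in> omega E" "m = j n" by (auto simp: naturals_def)
  \<comment> \<open>The least code has a unique preimage in \<open>\<omega>\<close>, as \<open>j\<close> is injective.\<close>
  then have "\<exists>!n. n \<in> omega E \<and> least_code (norm2 v) (j n)"
    using m inj_j by (metis inj_onD)
  then show ?thesis unfolding colour_def by (metis (no_types, lifting) theI')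
qed

lemma internal_colour: "internal_fun E (carrier V) (omega E) colour"
proof -
  have eq: "v \<in> carrier V \<and> n \<in> omega E \<and> (\<exists>m. (n \<in> omega E \<and> m = j n) \<and> least_code (norm2 v) m)
      \<longleftrightarrow> v \<in> carrier V \<and> n = colour v" for v n
    using eq_colour_iff[of v n] by auto
  have "internal {opair E v n | v n. v \<in> carrier V \<and> n \<in> omega E \<and>
      (\<exists>m. (n \<in> omega E \<and> m = j n) \<and> least_code (norm2 v) m)}"
    by (intro internal_relation internal_V internal_omega definable_intros definable_graph_j)
  then have "internal {opair E v n | v n. v \<in> carrier V \<and> n = colour v}" by (simp only: eq)
  also have "{opair E v n | v n. v \<in> carrier V \<and> n = colour v}
      = {opair E v (colour v) | v. v \<in> carrier V}" by auto
  finally have "internal {opair E v (colour v) | v. v \<in> carrier V}" .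
  moreover have "colour v \<in> omega E" if "v \<in> carrier V" for v
    using eq_colour_iff[OF that, of "colour v"] by simp
  ultimately show ?thesis by (simp add: internal_fun_def)
qed

lemma colour_eq_imp_norm2_eq:
  assumes "u \<in> carrier V" "v \<in> carrier V" "colour u = colour v" shows "norm2 u = norm2 v"
  using eq_colour_iff[of u "colour u"] eq_colour_iff[of v "colour v"] assms is_code_unique
  by (auto simp: least_code_def)

end

theorem theorem2p12:
  fixes E :: "'m \<Rightarrow> 'm \<Rightarrow> bool"
    and Q :: "'m ring"
    and V :: "('m, 'm) module"
  assumes "ZF_model E"
    and "rational_field E Q"
    and "vector_space_in E Q V"
    and "\<exists>B. hamel_basis E Q V B"
  shows "\<exists>c. internal_fun E (carrier V) (omega E) c \<and>
    \<not> (\<exists>u\<in>carrier V. \<exists>v\<in>carrier V. \<exists>w\<in>carrier V.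
        u \<noteq> v \<and> u \<noteq> w \<and> v \<noteq> w \<and> monochromatic c (FS V {u, v, w}))"
proof -
  obtain B where B: "hamel_basis E Q V B" using assms(4) by blast
  obtain j where j: "internal_fun E (omega E) (carrier Q) j" "inj_on j (omega E)"
    "j (empty_set E) = \<zero>\<^bsub>Q\<^esub>" "\<forall>n\<in>omega E. j (succ_set E n) = j n \<oplus>\<^bsub>Q\<^esub> \<one>\<^bsub>Q\<^esub>"
    "\<forall>q\<in>carrier Q. \<exists>a\<in>omega E. \<exists>b\<in>omega E. \<exists>d\<in>omega E.
       j d \<noteq> \<zero>\<^bsub>Q\<^esub> \<and> q = (j a \<ominus>\<^bsub>Q\<^esub> j b) \<otimes>\<^bsub>Q\<^esub> inv\<^bsub>Q\<^esub> (j d)"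
    using assms(2) unfolding rational_field_def by blast
  interpret ZF_model E by fact
  interpret field Q using assms(2) by (simp add: rational_field_def)
  interpret module Q V using assms(3) by (simp add: vector_space_in_def)
  interpret internal_basis E Q j V B
    by unfold_locales
      (use assms(2,3) B j in \<open>auto simp: rational_field_def vector_space_in_def hamel_basis_def\<close>)
  show ?thesis
  proof (intro exI[of _ colour] conjI internal_colour notI)
    assume "\<exists>u\<in>carrier V. \<exists>v\<in>carrier V. \<exists>w\<in>carrier V.
        u \<noteq> v \<and> u \<noteq> w \<and> v \<noteq> w \<and> monochromatic colour (FS V {u, v, w})"
    then obtain u v w where uvw: "u \<in> carrier V" "v \<in> carrier V" "w \<in> carrier V"
      "u \<noteq> v" "u \<noteq> w" "v \<noteq> w" and mono: "monochromatic colour (FS V {u, v, w})" by blast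
    have "FS V {u, v, w} \<subseteq> carrier V"
      using uvw(1-3) by (auto simp: FS_def intro!: M.finsum_closed)
    then have "norm2 x = norm2 y" if "x \<in> FS V {u, v, w}" "y \<in> FS V {u, v, w}" for x y
      using colour_eq_imp_norm2_eq[of x y] mono that unfolding monochromatic_def by blast
    then show False using norm2_not_constant_on_FS[OF uvw] by blast
  qed
qed

end
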